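(* Let $U\subsetneq\mathbb{C}$ be a simply connected domain containing $0$, and let $W$ be an open half-plane or an open quarter-plane containing $0$. Suppose that $\mathrm{H}(U)>\mathrm{H}(W)$. Then $$\lim_{t\to\infty} \frac{\mathbf{P}(T^W>t)}{\mathbf{P}(T^U>t)} = \infty.$$
   Context: $Z_t = X_t + iY_t$, $t\ge 0$, is standard planar Brownian motion with $Z_0=0$ almost surely; $\mathbf{P}$ and $\mathbf{E}$ are the corresponding probability measure and expectation. For a domain $D\subseteq\mathbb{C}$ containing $0$, $T^D = \inf\{t>0 : Z_t\notin D\}$ is the first exit time from $D$. For a domain $V$ containing $0$, $\mathrm{H}(V) = \sup\{p>0 : \mathbf{E}[(T^V)^p]<\infty\}$ (possibly $+\infty$). An open quarter-plane is the image of $\{z : \mathrm{Re}(z)>0,\ \mathrm{Im}(z)>0\}$ under a rotation followed by a translation. *)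

theory Defs
  imports "HOL-Probability.Probability"
begin

(* Continuity is required of every path, not merely of almost every path: M need not be
   complete, and this makes the events {T > t} below measurable. *)
locale standard_brownian_motion = prob_space M for M :: "'a measure" +
  fixes X :: "real \<Rightarrow> 'a \<Rightarrow> real"
  assumes random_variable_at: "t \<ge> 0 \<Longrightarrow> X t \<in> borel_measurable M"
    and start_zero: "AE \<omega> in M. X 0 \<omega> = 0"
    and normal_increments: "0 \<le> s \<Longrightarrow> s < t \<Longrightarrow>
      distributed M lborel (\<lambda>\<omega>. X t \<omega> - X s \<omega>) (\<lambda>x. ennreal (normal_density 0 (sqrt (t - s)) x))"
    and independent_increments: "0 \<le> \<tau> 0 \<Longrightarrow> (\<And>i. i < n \<Longrightarrow> \<tau> i < \<tau> (Suc i)) \<Longrightarrow>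
      indep_vars (\<lambda>_. borel) (\<lambda>i \<omega>. X (\<tau> (Suc i)) \<omega> - X (\<tau> i) \<omega>) {..<n::nat}"
    and continuous_paths: "\<omega> \<in> space M \<Longrightarrow> continuous_on {0..} (\<lambda>t. X t \<omega>)"

locale standard_planar_brownian_motion = prob_space M for M :: "'a measure" +
  fixes Z :: "real \<Rightarrow> 'a \<Rightarrow> complex"
  assumes brownian_Re: "standard_brownian_motion M (\<lambda>t \<omega>. Re (Z t \<omega>))"
    and brownian_Im: "standard_brownian_motion M (\<lambda>t \<omega>. Im (Z t \<omega>))"
    and independent_Re_Im:
      "indep_var (PiM {0..} (\<lambda>_. borel)) (\<lambda>\<omega>. \<lambda>t\<in>{0..}. Re (Z t \<omega>))
                 (PiM {0..} (\<lambda>_. borel)) (\<lambda>\<omega>. \<lambda>t\<in>{0..}. Im (Z t \<omega>))"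

(* Infinite on paths that never leave D. *)
definition exit_time :: "(real \<Rightarrow> 'a \<Rightarrow> complex) \<Rightarrow> complex set \<Rightarrow> 'a \<Rightarrow> ennreal" where
  "exit_time Z D \<omega> = (INF t\<in>{t. t > 0 \<and> Z t \<omega> \<notin> D}. ennreal t)"

(* Only used for p > 0, so that infinity to the power p is infinity. *)
definition ennreal_powr :: "ennreal \<Rightarrow> real \<Rightarrow> ennreal" where
  "ennreal_powr x p = (if x = \<infinity> then \<infinity> else ennreal (enn2real x powr p))"

definition exit_moment_exponent ::
  "'a measure \<Rightarrow> (real \<Rightarrow> 'a \<Rightarrow> complex) \<Rightarrow> complex set \<Rightarrow> ennreal" where
  "exit_moment_exponent M Z V =
    (SUP p\<in>{p. p > 0 \<and> (\<integral>\<^sup>+\<omega>. ennreal_powr (exit_time Z V \<omega>) p \<partial>M) < \<infinity>}. ennreal p)"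

definition rotate_translate :: "real \<Rightarrow> complex \<Rightarrow> complex \<Rightarrow> complex" where
  "rotate_translate \<theta> a z = a + cis \<theta> * z"

definition open_half_plane :: "complex set \<Rightarrow> bool" where
  "open_half_plane W \<longleftrightarrow> (\<exists>\<theta> a. W = rotate_translate \<theta> a ` {z. Re z > 0})"

definition open_quarter_plane :: "complex set \<Rightarrow> bool" where
  "open_quarter_plane W \<longleftrightarrow> (\<exists>\<theta> a. W = rotate_translate \<theta> a ` {z. Re z > 0 \<and> Im z > 0})"

end

theory Submission
  imports Defs
begin

text \<open>
  A finite moment of order \<open>p > H(W)\<close> gives \<open>P(T\<^sup>U > t) \<le> K t\<^bsup>-p\<^esup>\<close> by Markov's inequality. For a half-plane
  (\<open>h = 1/2\<close>) or a quarter-plane (\<open>h = 1\<close>), \<open>P(T\<^sup>W > t)\<close> lies between two positive multiples of \<open>t\<^bsup>-h\<^esup>\<close>, by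
  rotation invariance, independence of the coordinates and the reflection principle in each of them.
  The upper bound gives \<open>H(W) \<ge> h\<close>, hence \<open>p > h\<close>, and the lower bound makes the ratio grow like \<open>t\<^bsup>p - h\<^esup>\<close>.
  Since \<open>x / 0 = 0\<close>, one also needs \<open>P(T\<^sup>U > t) > 0\<close>, which holds because the motion stays in a small
  square with positive probability.

  No strong Markov property is used: all estimates are made for the Gaussian random walk on a time grid,
  where the only error comes from long steps and vanishes as the grid is refined, because
  \<open>n P(\<bar>N(0, t/n)\<bar> > \<epsilon>) \<rightarrow> 0\<close>.
\<close>

subsection \<open>Random walks killed outside a set\<close>

text \<open>Upper and lower bounds use the grids differently. Survival in continuous time implies
  survival on any one grid, so an upper bound may fix its grid after \<open>t\<close> is chosen. A
  lower bound must hold on all sufficiently fine dyadic grids, because the continuous event is the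
  decreasing limit of the grid events.

  A walk jumps over a barrier instead of hitting it, so the reflection identity splits into two
  inequalities for a test function that is odd about the barrier. For the lower half-line bound
  every overshoot lands where this function is nonpositive, and there is no error at all; for the
  upper one the barrier is moved by \<open>1\<close>. Long steps are controlled by the fourth
  moment: \<open>n\<close> steps of variance \<open>t / n\<close> cost a total of order
  \<open>t\<^sup>2 / n\<close>, whereas the second moment would leave a constant.

  Rotation invariance is applied to grid increments only. One product formula on boxes yields the
  law of the rotated steps, the independence within each coordinate and the independence between the
  coordinates.\<close>

locale iid_walk = prob_space M for M :: "'a measure" +
  fixes \<xi> :: "nat \<Rightarrow> 'a \<Rightarrow> real" and n :: nat and \<mu> :: "real measure"
  assumes indep: "indep_vars (\<lambda>_. borel) \<xi> {..<n}"
    and distr_step: "i < n \<Longrightarrow> distr M borel (\<xi> i) = \<mu>"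
    and prob_space_law: "prob_space \<mu>"
    and sets_law [measurable_cong]: "sets \<mu> = sets borel"
begin

definition S :: "nat \<Rightarrow> 'a \<Rightarrow> real" where
  "S k \<omega> = (\<Sum>i<k. \<xi> i \<omega>)"

definition alive :: "real set \<Rightarrow> nat \<Rightarrow> 'a set" where
  "alive I k = {\<omega> \<in> space M. \<forall>j\<le>k. S j \<omega> \<in> I}"

lemma step_measurable [measurable]: "i < n \<Longrightarrow> \<xi> i \<in> borel_measurable M"
  using indep by (auto simp: indep_vars_def)

lemma S_measurable [measurable]: "k \<le> n \<Longrightarrow> S k \<in> borel_measurable M"
  unfolding S_def[abs_def] by (rule borel_measurable_sum) (auto intro: step_measurable)

lemma alive_sets [measurable]:
  assumes [measurable]: "I \<in> sets borel" and "k \<le> n"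
  shows "alive I k \<in> sets M"
proof -
  have "alive I k = (\<Inter>j\<in>{..k}. {\<omega> \<in> space M. S j \<omega> \<in> I})"
    by (auto simp: alive_def)
  also have "\<dots> \<in> sets M"
  proof (rule sets.finite_INT)
    fix j assume "j \<in> {..k}"
    then have [measurable]: "S j \<in> borel_measurable M" using assms(2) by simp
    show "{\<omega> \<in> space M. S j \<omega> \<in> I} \<in> sets M" by measurable
  qed auto
  finally show ?thesis .
qed

text \<open>This is the Markov property at time \<open>k\<close>: \<open>S k\<close> and
  \<open>alive I k\<close> are functions of the first \<open>k\<close> steps, which are independent
  of \<open>\<xi> k\<close>, so Fubini integrates out the next step.\<close>

lemma integral_step:
  fixes u :: "real \<Rightarrow> real"
  assumes k: "k < n" and [measurable]: "I \<in> sets borel" and [measurable]: "u \<in> borel_measurable borel"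
    and bounded: "\<And>x. \<bar>u x\<bar> \<le> C"
  shows "(\<integral>\<omega>. u (S (Suc k) \<omega>) * indicator (alive I k) \<omega> \<partial>M) =
         (\<integral>\<omega>. (\<integral>y. u (S k \<omega> + y) \<partial>\<mu>) * indicator (alive I k) \<omega> \<partial>M)"
proof -
  define H :: "(nat \<Rightarrow> real) measure" where "H = PiM {..<k} (\<lambda>_. borel)"
  define X where "X = (\<lambda>\<omega>. restrict (\<lambda>i. \<xi> i \<omega>) {..<k})"
  define s where "s = (\<lambda>j (x::nat \<Rightarrow> real). \<Sum>i<j. x i)"
  define A where "A = {x \<in> space H. \<forall>j\<in>{..k}. s j x \<in> I}"
  define g where "g = (\<lambda>(x, y). u (s k x + y) * indicator A x)"
  interpret \<mu>: prob_space \<mu> by (rule prob_space_law)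
  have s_meas [measurable]: "s j \<in> borel_measurable H" if "j \<le> k" for j
    unfolding s_def H_def
    by (rule borel_measurable_sum, rule measurable_component_singleton) (use that in auto)
  have [measurable]: "A \<in> sets H"
  proof -
    have "A = (\<Inter>j\<in>{..k}. {x \<in> space H. s j x \<in> I})" by (auto simp: A_def)
    also have "\<dots> \<in> sets H"
    proof (rule sets.finite_INT)
      fix j assume "j \<in> {..k}"
      then have [measurable]: "s j \<in> borel_measurable H" by simp
      show "{\<omega> \<in> space H. s j \<omega> \<in> I} \<in> sets H" by measurable
    qed auto
    finally show ?thesis .
  qed
  have iv: "indep_var H X (PiM {k} (\<lambda>_. borel)) (\<lambda>\<omega>. restrict (\<lambda>i. \<xi> i \<omega>) {k})"
    unfolding H_def X_def using k by (intro indep_var_restrict[OF indep]) auto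
  define K :: "(nat \<Rightarrow> real) measure" where "K = PiM {k} (\<lambda>_. borel)"
  define Y where "Y = (\<lambda>\<omega>. restrict (\<lambda>i. \<xi> i \<omega>) {k})"
  have X_meas [measurable]: "X \<in> measurable M H" and Y_meas [measurable]: "Y \<in> measurable M K"
    and XY: "distr M H X \<Otimes>\<^sub>M distr M K Y = distr M (H \<Otimes>\<^sub>M K) (\<lambda>\<omega>. (X \<omega>, Y \<omega>))"
    using iv unfolding indep_var_distribution_eq K_def Y_def by auto
  have [measurable]: "\<xi> k \<in> borel_measurable M" using k by simp
  have [measurable]: "(\<lambda>x. x k) \<in> borel_measurable K" unfolding K_def by simp
  interpret Dk: prob_space "distr M borel (\<xi> k)" by (rule prob_space_distr) simp
  have Yk: "distr (distr M K Y) borel (\<lambda>x. x k) = distr M borel (\<xi> k)"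
    using Y_meas by (subst distr_distr) (simp_all add: comp_def Y_def)
  \<comment> \<open>Independence is available for the restriction of the family to the index set
    \<open>{k}\<close>. Projecting to the coordinate \<open>k\<close> turns it into independence
    from the real variable \<open>\<xi> k\<close>.\<close>
  have "distr M H X \<Otimes>\<^sub>M distr M borel (\<xi> k)
      = distr (distr M H X) H (\<lambda>x. x) \<Otimes>\<^sub>M distr (distr M K Y) borel (\<lambda>x. x k)"
    unfolding Yk by (simp add: distr_id2)
  also have "\<dots> = distr (distr M H X \<Otimes>\<^sub>M distr M K Y) (H \<Otimes>\<^sub>M borel) (\<lambda>(x, y). (x, y k))"
    by (rule pair_measure_distr)
      (auto simp: Yk intro!: prob_space_imp_sigma_finite Dk.prob_space_axioms)
  also have "\<dots> = distr M (H \<Otimes>\<^sub>M borel) (\<lambda>\<omega>. (X \<omega>, \<xi> k \<omega>))"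
    unfolding XY by (subst distr_distr) (auto simp: comp_def, simp add: Y_def)
  finally have joint: "distr M H X \<Otimes>\<^sub>M distr M borel (\<xi> k) = distr M (H \<Otimes>\<^sub>M borel) (\<lambda>\<omega>. (X \<omega>, \<xi> k \<omega>))" .
  have joint: "distr M H X \<Otimes>\<^sub>M \<mu> = distr M (H \<Otimes>\<^sub>M borel) (\<lambda>\<omega>. (X \<omega>, \<xi> k \<omega>))"
    using joint distr_step[OF k] by simp
  interpret D: prob_space "distr M H X" by (rule prob_space_distr) simp
  interpret P: pair_prob_space "distr M H X" \<mu> ..
  have [measurable]: "s k \<in> borel_measurable H" by simp
  have g_meas [measurable]: "g \<in> borel_measurable (H \<Otimes>\<^sub>M borel)"
  proof -
    have [measurable]: "(\<lambda>x. s k (fst x)) \<in> borel_measurable (H \<Otimes>\<^sub>M borel)"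
      by (rule measurable_compose[OF measurable_fst s_meas]) simp
    have [measurable]: "(\<lambda>x. indicator A (fst x) :: real) \<in> borel_measurable (H \<Otimes>\<^sub>M (borel :: real measure))"
      by (rule measurable_compose[OF measurable_fst]) simp
    show ?thesis unfolding g_def split_beta' by measurable
  qed
  have S_eq: "S j \<omega> = s j (X \<omega>)" if "j \<le> k" for j \<omega>
    using that by (auto simp: S_def s_def X_def intro!: sum.cong)
  have al: "indicator (alive I k) \<omega> = (indicator A (X \<omega>) :: real)" if "\<omega> \<in> space M" for \<omega>
    using that measurable_space[OF X_meas that] by (auto simp: alive_def A_def S_eq split: split_indicator)
  have "0 \<le> C" using bounded[of 0] by simp
  then have "\<bar>g z\<bar> \<le> C" for z
    using bounded by (cases z) (auto simp: g_def split: split_indicator)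
  then have int: "integrable (distr M H X \<Otimes>\<^sub>M \<mu>) g"
    by (intro P.integrable_const_bound[where B="C"]) auto
  have "(\<integral>\<omega>. u (S (Suc k) \<omega>) * indicator (alive I k) \<omega> \<partial>M) = (\<integral>\<omega>. g (X \<omega>, \<xi> k \<omega>) \<partial>M)"
    by (rule Bochner_Integration.integral_cong) (simp_all add: g_def al S_eq[symmetric], simp add: S_def)
  also have "\<dots> = integral\<^sup>L (distr M (H \<Otimes>\<^sub>M borel) (\<lambda>\<omega>. (X \<omega>, \<xi> k \<omega>))) g"
    by (subst integral_distr) auto
  also have "\<dots> = (\<integral>x. (\<integral>y. g (x, y) \<partial>\<mu>) \<partial>distr M H X)"
    unfolding joint[symmetric] by (rule P.integral_fst'[symmetric]) (use int in simp)
  also have "\<dots> = (\<integral>\<omega>. (\<integral>y. g (X \<omega>, y) \<partial>\<mu>) \<partial>M)"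
    by (subst integral_distr) auto
  also have "\<dots> = (\<integral>\<omega>. (\<integral>y. u (S k \<omega> + y) \<partial>\<mu>) * indicator (alive I k) \<omega> \<partial>M)"
    by (rule Bochner_Integration.integral_cong) (simp_all add: g_def al S_eq)
  finally show ?thesis .
qed

text \<open>
  \<open>u (n - k) (S k)\<close> is a martingale. Stopped at the exit from \<open>I\<close>, it loses a nonpositive amount unless the
  last step lies in \<open>B\<close>; such overshooting steps account for the error term.
\<close>
lemma stopped_walk_bound:
  fixes u :: "nat \<Rightarrow> real \<Rightarrow> real"
  assumes I: "I \<in> sets borel" and B: "B \<in> sets borel" and um: "\<And>m. u m \<in> borel_measurable borel"
    and bounded: "\<And>m x. \<bar>u m x\<bar> \<le> C"
    and harmonic: "\<And>m x. u (Suc m) x = (\<integral>y. u m (x + y) \<partial>\<mu>)"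
    and overshoot: "\<And>m x y. x \<in> I \<Longrightarrow> x + y \<notin> I \<Longrightarrow> u m (x + y) \<le> indicator B y"
    and "0 \<in> I"
  shows "u n 0 - n * measure \<mu> B \<le> (\<integral>\<omega>. u 0 (S n \<omega>) * indicator (alive I n) \<omega> \<partial>M)"
proof -
  note [measurable] = I B um
  \<comment> \<open>\<open>v k\<close> is the mean of the martingale on the paths still alive at
    time \<open>k\<close>; the induction shows that each step lowers it by at most
    \<open>measure \<mu> B\<close>.\<close>
  define v where "v k = (\<integral>\<omega>. u (n - k) (S k \<omega>) * indicator (alive I k) \<omega> \<partial>M)" for k
  have bd: "\<bar>u m x * indicator Q z\<bar> \<le> C" for m x Q and z :: 'a
    using bounded[of m x] by (auto split: split_indicator intro: order_trans[OF abs_ge_zero])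
  have "u n 0 - k * measure \<mu> B \<le> v k" if "k \<le> n" for k
    using that
  proof (induction k)
    case 0
    have "v 0 = (\<integral>\<omega>. u n 0 \<partial>M)"
      unfolding v_def by (rule Bochner_Integration.integral_cong)
        (use \<open>0 \<in> I\<close> in \<open>auto simp: alive_def S_def\<close>)
    then show ?case by (simp add: prob_space)
  next
    case (Suc k)
    then have k: "k < n" by simp
    then obtain m where m: "n - k = Suc m" "n - Suc k = m" by (metis Suc_diff_Suc)
    have [measurable]: "S k \<in> borel_measurable M" "S (Suc k) \<in> borel_measurable M" "\<xi> k \<in> borel_measurable M"
      "alive I k \<in> sets M" "alive I (Suc k) \<in> sets M"
      using k by auto
    have "v k = (\<integral>\<omega>. (\<integral>y. u m (S k \<omega> + y) \<partial>\<mu>) * indicator (alive I k) \<omega> \<partial>M)"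
      by (simp add: v_def m harmonic)
    also have "\<dots> = (\<integral>\<omega>. u m (S (Suc k) \<omega>) * indicator (alive I k) \<omega> \<partial>M)"
      by (rule integral_step[symmetric, OF k I um bounded])
    also have "\<dots> \<le> (\<integral>\<omega>. u m (S (Suc k) \<omega>) * indicator (alive I (Suc k)) \<omega> + indicator B (\<xi> k \<omega>) \<partial>M)"
    proof (rule integral_mono)
      show "integrable M (\<lambda>\<omega>. u m (S (Suc k) \<omega>) * indicator (alive I k) \<omega>)"
        by (rule integrable_const_bound[where B=C]) (use bd in auto)
      show "integrable M (\<lambda>\<omega>. u m (S (Suc k) \<omega>) * indicator (alive I (Suc k)) \<omega> + indicator B (\<xi> k \<omega>))"
        by (intro Bochner_Integration.integrable_add integrable_const_bound[where B=C] integrable_const_bound[where B=1])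
          (use bd in \<open>auto split: split_indicator\<close>)
      fix \<omega> assume \<omega>: "\<omega> \<in> space M"
      have e: "S (Suc k) \<omega> = S k \<omega> + \<xi> k \<omega>" by (simp add: S_def)
      show "u m (S (Suc k) \<omega>) * indicator (alive I k) \<omega>
          \<le> u m (S (Suc k) \<omega>) * indicator (alive I (Suc k)) \<omega> + indicator B (\<xi> k \<omega>)"
      \<comment> \<open>The two survival indicators differ only if the walk leaves \<open>I\<close>
        exactly at step \<open>Suc k\<close>; then \<open>S k \<omega>\<close> is in
        \<open>I\<close> and \<open>S (Suc k) \<omega>\<close> is not, which is the situation of
        \<open>overshoot\<close>.\<close>
      proof (cases "\<omega> \<in> alive I k \<and> \<omega> \<notin> alive I (Suc k)")
        case True
        then have "S k \<omega> \<in> I" "S (Suc k) \<omega> \<notin> I" by (auto simp: alive_def le_Suc_eq)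
        then show ?thesis using True overshoot[of "S k \<omega>" "\<xi> k \<omega>" m] by (simp add: e)
      next
        case False
        then show ?thesis by (auto simp: alive_def split: split_indicator)
      qed
    qed
    also have "\<dots> = v (Suc k) + (\<integral>\<omega>. (indicator B (\<xi> k \<omega>) :: real) \<partial>M)"
      unfolding v_def m
      by (intro Bochner_Integration.integral_add integrable_const_bound[where B=C] integrable_const_bound[where B=1])
          (use bd in \<open>auto split: split_indicator\<close>)
    also have "(\<integral>\<omega>. (indicator B (\<xi> k \<omega>) :: real) \<partial>M) = (\<integral>y. (indicator B y :: real) \<partial>distr M borel (\<xi> k))"
      by (subst integral_distr) auto
    also have "\<dots> = measure \<mu> B"
      using sets_eq_imp_space_eq[OF sets_law] by (simp add: distr_step[OF k])
    finally show ?case using Suc by (simp add: algebra_simps)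
  qed
  from this[of n] show ?thesis by (simp add: v_def)
qed

end

subsection \<open>Centred Gaussian measures\<close>

text \<open>The parameter is the variance, not the standard deviation.\<close>
definition gauss :: "real \<Rightarrow> real measure" where
  "gauss h = density lborel (\<lambda>x. ennreal (normal_density 0 (sqrt h) x))"

lemma sets_gauss [measurable_cong, simp]: "sets (gauss h) = sets borel"
  by (simp add: gauss_def)

lemma space_gauss [simp]: "space (gauss h) = UNIV"
  by (simp add: gauss_def)

lemma prob_space_gauss: "h > 0 \<Longrightarrow> prob_space (gauss h)"
  unfolding gauss_def by (rule prob_space_normal_density) simp

lemma normal_density_uminus: "normal_density 0 \<sigma> (- x) = normal_density 0 \<sigma> x"
  by (simp add: normal_density_def)

lemma integral_gauss:
  fixes f :: "real \<Rightarrow> real"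
  shows "f \<in> borel_measurable borel \<Longrightarrow>
  (\<integral>y. f y \<partial>gauss h) = (\<integral>y. normal_density 0 (sqrt h) y * f y \<partial>lborel)"
  unfolding gauss_def by (subst integral_density) auto

lemma integral_gauss_uminus:
  fixes f :: "real \<Rightarrow> real"
  assumes [measurable]: "f \<in> borel_measurable borel"
  shows "(\<integral>y. f (- y) \<partial>gauss h) = (\<integral>y. f y \<partial>gauss h)"
proof -
  have "(\<integral>y. f y \<partial>gauss h) = (\<integral>y. normal_density 0 (sqrt h) (- y) * f (- y) \<partial>lborel)"
    by (subst integral_gauss, simp, subst lborel_integral_real_affine[of "-1" _ 0]) auto
  then show ?thesis by (simp add: integral_gauss normal_density_uminus)
qed

text \<open>Real part of the characteristic function of the standard normal law, rescaled by
  \<open>sqrt h\<close>. It supplies the eigenvalue of the cosine under one step of the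
  walk.\<close>

lemma integral_cos_gauss:
  assumes "h > 0"
  shows "(\<integral>y. cos (l * y) \<partial>gauss h) = exp (- (l\<^sup>2 * h / 2))"
proof -
  interpret N: prob_space "std_normal_distribution"
    using prob_space_normal_density[of 1 0] by simp
  have "exp (- (s^2) / 2) = Re (char std_normal_distribution s)" for s
    by (simp add: char_std_normal_distribution)
  also have "Re (char std_normal_distribution s) = (\<integral>y. cos (s * y) \<partial>std_normal_distribution)" for s
  proof -
    have i: "integrable std_normal_distribution (\<lambda>y. iexp (s * y))"
      by (rule N.integrable_const_bound[where B=1]) auto
    show ?thesis
      unfolding char_def using integral_Re[OF i, symmetric] by (simp add: Re_exp)
  qed
  also have "(\<integral>y. cos (s * y) \<partial>std_normal_distribution) = (\<integral>y. std_normal_density y * cos (s * y) \<partial>lborel)" for s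
    by (subst integral_density) auto
  finally have std: "(\<integral>y. std_normal_density y * cos (s * y) \<partial>lborel) = exp (- (s^2) / 2)" for s ..
  have "(\<integral>y. cos (l * y) \<partial>gauss h) = (\<integral>y. normal_density 0 (sqrt h) y * cos (l * y) \<partial>lborel)"
    by (simp add: integral_gauss)
  also have "\<dots> = sqrt h * (\<integral>y. normal_density 0 (sqrt h) (sqrt h * y) * cos (l * (sqrt h * y)) \<partial>lborel)"
    using assms by (subst lborel_integral_real_affine[of "sqrt h" _ 0]) auto
  also have "\<dots> = (\<integral>y. sqrt h * (normal_density 0 (sqrt h) (sqrt h * y) * cos (l * (sqrt h * y))) \<partial>lborel)"
    by simp
  also have "\<dots> = (\<integral>y. std_normal_density y * cos (l * sqrt h * y) \<partial>lborel)"
    using assms by (intro Bochner_Integration.integral_cong)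
      (auto simp: normal_density_def real_sqrt_mult power_mult_distrib mult_ac field_simps)
  also have "\<dots> = exp (- (l\<^sup>2 * h / 2))"
    using assms by (simp add: std power_mult_distrib)
  finally show ?thesis .
qed

text \<open>Markov's inequality for \<open>y ^ 4\<close>. The square of \<open>h\<close> in the
  bound is what makes \<open>n\<close> times the tail vanish when \<open>h = t / n\<close> and
  \<open>n\<close> grows.\<close>

lemma gauss_tail:
  assumes "h > 0" "\<epsilon> > 0"
  shows "measure (gauss h) {y. \<bar>y\<bar> > \<epsilon>} \<le> 3 * h\<^sup>2 / \<epsilon> ^ 4"
proof -
  interpret prob_space "gauss h" by (rule prob_space_gauss) fact
  have h: "sqrt h > 0" using assms by simp
  have b: "has_bochner_integral lborel (\<lambda>x. normal_density 0 (sqrt h) x * x ^ 4) (3 * h\<^sup>2)"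
    using normal_moment_even[OF h, of 0 2] assms by (simp add: fact_numeral power_divide)
  have i: "integrable (gauss h) (\<lambda>y. y ^ 4)"
    unfolding gauss_def using b by (subst integrable_density) (auto simp: has_bochner_integral_iff)
  have v: "(\<integral>y. y ^ 4 \<partial>gauss h) = 3 * h\<^sup>2"
    using b by (simp add: integral_gauss has_bochner_integral_iff)
  have "measure (gauss h) {y. \<bar>y\<bar> > \<epsilon>} \<le> measure (gauss h) {y \<in> space (gauss h). y ^ 4 \<ge> \<epsilon> ^ 4}"
  proof (rule finite_measure_mono)
    have "\<epsilon> ^ 4 \<le> y ^ 4" if "\<bar>y\<bar> > \<epsilon>" for y :: real
      using power_mono[of \<epsilon> "\<bar>y\<bar>" 4] that assms by (simp add: power_even_abs)
    then show "{y. \<bar>y\<bar> > \<epsilon>} \<subseteq> {y \<in> space (gauss h). y ^ 4 \<ge> \<epsilon> ^ 4}" by auto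
    show "{y \<in> space (gauss h). y ^ 4 \<ge> \<epsilon> ^ 4} \<in> events" by simp
  qed
  also have "\<dots> \<le> (\<integral>y. y ^ 4 \<partial>gauss h) / \<epsilon> ^ 4"
    by (rule integral_Markov_inequality_measure[where A="{}"]) (use i assms in auto)
  finally show ?thesis by (simp add: v)
qed

text \<open>For \<open>t \<ge> 1\<close> and \<open>\<bar>y\<bar> < a\<close> the exponent
  \<open>y\<^sup>2 / (2 * t)\<close> is at most \<open>a\<^sup>2 / 2\<close>, so the density is
  bounded below by a multiple of \<open>1 / sqrt t\<close> on an interval of length
  \<open>2 * a\<close>.\<close>

lemma gauss_interval_lower:
  assumes "t \<ge> 1" "a > 0"
  shows "2 * a * exp (- (a\<^sup>2 / 2)) / sqrt (2 * pi) / sqrt t \<le> measure (gauss t) {y. \<bar>y\<bar> < a}"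
proof -
  interpret prob_space "gauss t" by (rule prob_space_gauss) (use assms in simp)
  have "exp (- (a\<^sup>2 / 2)) / sqrt (2 * pi) / sqrt t * indicator {-a<..<a} y
     \<le> normal_density 0 (sqrt t) y * indicator {-a<..<a} y" for y
  proof (cases "y \<in> {-a<..<a}")
    case True
    then have "y\<^sup>2 \<le> a\<^sup>2" using assms by (intro abs_le_square_iff[THEN iffD1]) auto
    then have "y\<^sup>2 / (2 * t) \<le> a\<^sup>2 / 2" using assms by (intro frac_le) auto
    then have "exp (- (a\<^sup>2 / 2)) \<le> exp (- (y\<^sup>2 / (2 * t)))" by simp
    then show ?thesis using assms True
      by (simp add: normal_density_def real_sqrt_mult field_simps)
  qed simp
  then have "(\<integral>y. exp (- (a\<^sup>2 / 2)) / sqrt (2 * pi) / sqrt t * indicator {-a<..<a} y \<partial>lborel)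
     \<le> (\<integral>y. normal_density 0 (sqrt t) y * indicator {-a<..<a} y \<partial>lborel)"
    using assms by (intro integral_mono integrable_real_mult_indicator integrable_normal_density
      integrable_mult_right integrable_real_indicator) auto
  moreover have "(\<integral>y. normal_density 0 (sqrt t) y * indicator {-a<..<a} y \<partial>lborel) = measure (gauss t) {-a<..<a}"
    by (subst integral_gauss[symmetric]) auto
  moreover have "{y. \<bar>y\<bar> < a} = {-a<..<a}" by auto
  ultimately show ?thesis using assms by (simp add: mult_ac)
qed

lemma gauss_interval_upper:
  assumes "t > 0" "a > 0"
  shows "measure (gauss t) {y. \<bar>y\<bar> \<le> a} \<le> 2 * a / sqrt (2 * pi) / sqrt t"
proof -
  interpret prob_space "gauss t" by (rule prob_space_gauss) (use assms in simp)
  have "normal_density 0 (sqrt t) y * indicator {-a..a} y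
     \<le> 1 / sqrt (2 * pi) / sqrt t * indicator {-a..a} y" for y
    using assms by (auto simp: normal_density_def real_sqrt_mult field_simps split: split_indicator)
  then have "(\<integral>y. normal_density 0 (sqrt t) y * indicator {-a..a} y \<partial>lborel)
     \<le> (\<integral>y. 1 / sqrt (2 * pi) / sqrt t * indicator {-a..a} y \<partial>lborel)"
    using assms by (intro integral_mono integrable_real_mult_indicator integrable_normal_density
      integrable_mult_right integrable_real_indicator) auto
  moreover have "(\<integral>y. normal_density 0 (sqrt t) y * indicator {-a..a} y \<partial>lborel) = measure (gauss t) {-a..a}"
    by (subst integral_gauss[symmetric]) auto
  moreover have "{y. \<bar>y\<bar> \<le> a} = {-a..a}" by auto
  ultimately show ?thesis using assms by simp
qed

text \<open>By symmetry the integrand may be replaced by its average with the reflected one. That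
  average is \<open>1\<close> for \<open>\<bar>y\<bar> < b\<close>, \<open>1 / 2\<close> for
  \<open>\<bar>y\<bar> = b\<close> and \<open>0\<close> beyond, hence lies between the indicators of
  the open and the closed interval.\<close>

lemma gauss_sgn_bounds:
  assumes "t > 0" "b > 0"
  shows "measure (gauss t) {y. \<bar>y\<bar> < b} \<le> (\<integral>y. sgn (y + b) \<partial>gauss t)"
    and "(\<integral>y. sgn (y + b) \<partial>gauss t) \<le> measure (gauss t) {y. \<bar>y\<bar> \<le> b}"
proof -
  interpret prob_space "gauss t" by (rule prob_space_gauss) fact
  have i: "integrable (gauss t) (\<lambda>y. sgn (y + b))" "integrable (gauss t) (\<lambda>y. sgn (- y + b))"
    by (auto intro!: integrable_const_bound[where B=1] simp: sgn_if)
  have "(\<integral>y. sgn (y + b) \<partial>gauss t) = ((\<integral>y. sgn (y + b) \<partial>gauss t) + (\<integral>y. sgn (- y + b) \<partial>gauss t)) / 2"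
    using integral_gauss_uminus[of "\<lambda>y. sgn (y + b)" t] by simp
  also have "\<dots> = (\<integral>y. (sgn (y + b) + sgn (- y + b)) / 2 \<partial>gauss t)"
    using i by simp
  finally have e: "(\<integral>y. sgn (y + b) \<partial>gauss t) = (\<integral>y. (sgn (y + b) + sgn (- y + b)) / 2 \<partial>gauss t)" .
  have "(\<integral>y. indicator {y. \<bar>y\<bar> < b} y \<partial>gauss t) \<le> (\<integral>y. (sgn (y + b) + sgn (- y + b)) / 2 \<partial>gauss t)"
    using assms by (intro integral_mono integrable_const_bound[where B=1])
      (auto simp: sgn_if split: split_indicator)
  then show "measure (gauss t) {y. \<bar>y\<bar> < b} \<le> (\<integral>y. sgn (y + b) \<partial>gauss t)"
    unfolding e by simp
  have "(\<integral>y. (sgn (y + b) + sgn (- y + b)) / 2 \<partial>gauss t) \<le> (\<integral>y. indicator {y. \<bar>y\<bar> \<le> b} y \<partial>gauss t)"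
    using assms by (intro integral_mono integrable_const_bound[where B=1])
      (auto simp: sgn_if split: split_indicator)
  then show "(\<integral>y. sgn (y + b) \<partial>gauss t) \<le> measure (gauss t) {y. \<bar>y\<bar> \<le> b}"
    unfolding e by simp
qed

subsection \<open>Survival probabilities of Gaussian walks\<close>

text \<open>The \<open>m\<close>-th iterate of the transition operator of the walk, applied to
  \<open>f\<close>. The recursion makes the hypothesis \<open>harmonic\<close> of
  \<open>stopped_walk_bound\<close> hold by definition.\<close>

primrec walk_mean :: "real measure \<Rightarrow> (real \<Rightarrow> real) \<Rightarrow> nat \<Rightarrow> real \<Rightarrow> real" where
  "walk_mean \<mu> f 0 x = f x"
| "walk_mean \<mu> f (Suc m) x = (\<integral>y. walk_mean \<mu> f m (x + y) \<partial>\<mu>)"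

lemma walk_mean_measurable:
  assumes "f \<in> borel_measurable borel" "h > 0"
  shows "walk_mean (gauss h) f m \<in> borel_measurable borel"
proof (induction m)
  case 0
  then show ?case using assms by (simp cong: measurable_cong)
next
  case (Suc m)
  interpret prob_space "gauss h" by (rule prob_space_gauss) fact
  note [measurable] = Suc
  have "(\<lambda>x. \<integral>y. walk_mean (gauss h) f m (x + y) \<partial>gauss h) \<in> borel_measurable borel"
    by measurable
  then show ?case by (simp cong: measurable_cong)
qed

lemma walk_mean_bounded:
  assumes "f \<in> borel_measurable borel" "h > 0" and b: "\<And>x. \<bar>f x\<bar> \<le> 1"
  shows "\<bar>walk_mean (gauss h) f m x\<bar> \<le> 1"
proof (induction m arbitrary: x)
  case (Suc m)
  interpret prob_space "gauss h" by (rule prob_space_gauss) fact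
  note [measurable] = walk_mean_measurable[OF assms(1,2)]
  have i: "integrable (gauss h) (\<lambda>y. walk_mean (gauss h) f m (x + y))"
    by (rule integrable_const_bound[where B=1]) (use Suc in auto)
  have "\<bar>\<integral>y. walk_mean (gauss h) f m (x + y) \<partial>gauss h\<bar> \<le> (\<integral>y. \<bar>walk_mean (gauss h) f m (x + y)\<bar> \<partial>gauss h)"
    by (rule integral_abs_bound)
  also have "\<dots> \<le> 1"
    using i Suc by (intro integral_le_const) auto
  finally show ?case by simp
qed (simp add: b)

text \<open>Averaging over translates preserves monotonicity, and averaging against a symmetric law
  preserves oddness about \<open>- b\<close>; the sign function centred at \<open>- b\<close> has
  both properties.\<close>

lemma walk_mean_sgn:
  assumes "h > 0"
  shows "mono (walk_mean (gauss h) (\<lambda>x. sgn (x + b)) m)"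
    and "walk_mean (gauss h) (\<lambda>x. sgn (x + b)) m (- b - x) = - walk_mean (gauss h) (\<lambda>x. sgn (x + b)) m (- b + x)"
proof (induction m arbitrary: x)
  case 0
  { case 1 show ?case by (auto simp: mono_def sgn_if) }
  { case 2 show ?case by (auto simp: sgn_if) }
next
  case (Suc m)
  interpret prob_space "gauss h" by (rule prob_space_gauss) fact
  let ?E = "walk_mean (gauss h) (\<lambda>x. sgn (x + b))"
  have [measurable]: "?E m \<in> borel_measurable borel" for m
    by (rule walk_mean_measurable) (use assms in auto)
  have bd: "\<bar>?E m x\<bar> \<le> 1" for m x
    by (rule walk_mean_bounded) (use assms in \<open>auto simp: sgn_if\<close>)
  { case 1
    show ?case
    proof (rule monoI)
      fix x y :: real assume "x \<le> y"
      then show "?E (Suc m) x \<le> ?E (Suc m) y"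
        unfolding walk_mean.simps
        by (intro integral_mono integrable_const_bound[where B=1])
          (use bd in \<open>auto intro: monoD[OF Suc(1)]\<close>)
    qed }
  { case 2
    have "(\<integral>y. ?E m (- b - x + y) \<partial>gauss h) = (\<integral>y. ?E m (- b - (x + y)) \<partial>gauss h)"
      using integral_gauss_uminus[of "\<lambda>y. ?E m (- b - x + y)" h]
      by (simp add: diff_diff_eq[symmetric])
    also have "\<dots> = - (\<integral>y. ?E m (- b + (x + y)) \<partial>gauss h)"
      by (subst Suc(2)) simp
    finally show ?case by (simp add: algebra_simps) }
qed

text \<open>Oddness forces the value \<open>0\<close> at \<open>- b\<close>, and monotonicity then
  fixes the sign on either side.\<close>

lemma walk_mean_sgn_sign:
  assumes "h > 0"
  shows "x \<ge> - b \<Longrightarrow> walk_mean (gauss h) (\<lambda>x. sgn (x + b)) m x \<ge> 0"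
    and "x \<le> - b \<Longrightarrow> walk_mean (gauss h) (\<lambda>x. sgn (x + b)) m x \<le> 0"
proof -
  let ?E = "walk_mean (gauss h) (\<lambda>x. sgn (x + b)) m"
  have "?E (- b) = 0" using walk_mean_sgn(2)[OF assms, of b m 0] by simp
  then show "x \<ge> - b \<Longrightarrow> ?E x \<ge> 0" "x \<le> - b \<Longrightarrow> ?E x \<le> 0"
    using monoD[OF walk_mean_sgn(1)[OF assms, of b m], of "-b" x]
      monoD[OF walk_mean_sgn(1)[OF assms, of b m], of x "-b"] by auto
qed

locale gauss_walk = iid_walk M \<xi> n "gauss h" for M :: "'a measure" and \<xi> n h +
  assumes n_pos: "n > 0" and h_pos: "h > 0"
begin

lemma distr_S: "distr M borel (S n) = gauss (n * h)"
proof -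
  have "distributed M lborel (\<xi> i) (normal_density 0 (sqrt h))" if "i < n" for i
    using distr_step[OF that] step_measurable[OF that]
    unfolding distributed_def gauss_def by (auto cong: distr_cong)
  then have "distributed M lborel (\<lambda>x. \<Sum>i<n. \<xi> i x) (normal_density (\<Sum>i<n. 0) (sqrt (\<Sum>i<n. (sqrt h)\<^sup>2)))"
    using n_pos h_pos indep by (intro sum_indep_normal) auto
  then have "distr M lborel (\<lambda>x. \<Sum>i<n. \<xi> i x) = gauss (n * h)"
    using h_pos by (simp add: distributed_def gauss_def)
  then show ?thesis
    unfolding S_def[abs_def] by (simp cong: distr_cong)
qed

text \<open>With \<open>I = UNIV\<close> and \<open>B = {}\<close> there is neither an exit nor an
  error, so \<open>stopped_walk_bound\<close> applied to the function and to its negative gives both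
  inequalities.\<close>

lemma walk_mean_eq:
  assumes f [measurable]: "f \<in> borel_measurable borel" and b: "\<And>x. \<bar>f x\<bar> \<le> 1"
  shows "walk_mean (gauss h) f n 0 = (\<integral>y. f y \<partial>gauss (n * h))"
proof -
  note m = walk_mean_measurable[OF f h_pos] and bd = walk_mean_bounded[OF f h_pos b]
  have [measurable]: "S n \<in> borel_measurable M" by simp
  have e: "(\<integral>\<omega>. f (S n \<omega>) * indicator (alive UNIV n) \<omega> \<partial>M) = (\<integral>y. f y \<partial>gauss (n * h))"
    unfolding distr_S[symmetric]
    by (subst integral_distr) (auto simp: alive_def intro!: Bochner_Integration.integral_cong)
  have "walk_mean (gauss h) f n 0 - n * measure (gauss h) {}
      \<le> (\<integral>\<omega>. walk_mean (gauss h) f 0 (S n \<omega>) * indicator (alive UNIV n) \<omega> \<partial>M)"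
    by (rule stopped_walk_bound[where C=1]) (use m bd in auto)
  moreover have "- walk_mean (gauss h) f n 0 - n * measure (gauss h) {}
      \<le> (\<integral>\<omega>. - walk_mean (gauss h) f 0 (S n \<omega>) * indicator (alive UNIV n) \<omega> \<partial>M)"
    by (rule stopped_walk_bound[where C=1 and u="\<lambda>m x. - walk_mean (gauss h) f m x"]) (use m bd in auto)
  ultimately show ?thesis by (simp add: e)
qed

text \<open>
  Reflection principle: the martingale starting from \<open>sgn (x + a)\<close> is odd about \<open>- a\<close>, hence nonpositive
  beyond the barrier.
\<close>
lemma half_line_lower:
  assumes "a > 0"
  shows "measure (gauss (n * h)) {y. \<bar>y\<bar> < a} \<le> prob (alive {- a..} n)"
proof -
  let ?f = "\<lambda>x. sgn (x + a)"
  let ?E = "walk_mean (gauss h) ?f"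
  have m [measurable]: "?E m \<in> borel_measurable borel" for m
    by (rule walk_mean_measurable) (use h_pos in auto)
  have bd: "\<bar>?E m x\<bar> \<le> 1" for m x
    by (rule walk_mean_bounded) (use h_pos in \<open>auto simp: sgn_if\<close>)
  have [measurable]: "S n \<in> borel_measurable M" "alive {- a..} n \<in> sets M" by auto
  have "measure (gauss (n * h)) {y. \<bar>y\<bar> < a} \<le> (\<integral>y. ?f y \<partial>gauss (n * h))"
    using n_pos h_pos assms by (intro gauss_sgn_bounds) auto
  \<comment> \<open>The subtracted term is zero and only brings the expression into the form of
    \<open>stopped_walk_bound\<close>: an exit lands below \<open>- a\<close>, where
    \<open>?E\<close> is nonpositive, so \<open>B = {}\<close> is admissible.\<close>
  also have "\<dots> = ?E n 0 - n * measure (gauss h) {}"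
    by (subst walk_mean_eq) (auto simp: sgn_if)
  also have "\<dots> \<le> (\<integral>\<omega>. ?E 0 (S n \<omega>) * indicator (alive {- a..} n) \<omega> \<partial>M)"
    by (rule stopped_walk_bound[where C=1]) (use m bd assms h_pos in \<open>auto intro: walk_mean_sgn_sign\<close>)
  also have "\<dots> \<le> (\<integral>\<omega>. indicator (alive {- a..} n) \<omega> \<partial>M)"
    by (intro integral_mono integrable_const_bound[where B=1])
      (auto simp: sgn_if split: split_indicator)
  finally show ?thesis by simp
qed

text \<open>
  Reflecting at \<open>- (a + 1)\<close> instead reverses the inequality, at the price of the steps longer than \<open>1\<close>.
\<close>
lemma half_line_upper:
  assumes "a > 0"
  shows "prob (alive {- a..} n) \<le> measure (gauss (n * h)) {y. \<bar>y\<bar> \<le> a + 1} + n * (3 * h\<^sup>2)"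
proof -
  let ?f = "\<lambda>x. sgn (x + (a + 1))"
  let ?E = "walk_mean (gauss h) ?f"
  have m [measurable]: "?E m \<in> borel_measurable borel" for m
    by (rule walk_mean_measurable) (use h_pos in auto)
  have bd: "\<bar>?E m x\<bar> \<le> 1" for m x
    by (rule walk_mean_bounded) (use h_pos in \<open>auto simp: sgn_if\<close>)
  have [measurable]: "S n \<in> borel_measurable M" "alive {- a..} n \<in> sets M" by auto
  \<comment> \<open>A step of length at most \<open>1\<close> from \<open>{- a..}\<close> cannot
    pass \<open>- (a + 1)\<close>, and above that point \<open>?E\<close> is nonnegative. Longer
    steps are covered by \<open>\<bar>?E\<bar> \<le> 1\<close>.\<close>
  have over: "- ?E m (x + y) \<le> indicator {y. \<bar>y\<bar> > 1} y" if "x \<in> {- a..}" for m x y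
  proof (cases "\<bar>y\<bar> > 1")
    case True
    then show ?thesis using bd[of m "x + y"] by simp
  next
    case False
    then have "x + y \<ge> - (a + 1)" using that by auto
    then show ?thesis using walk_mean_sgn_sign(1)[OF h_pos, of "a + 1" "x + y" m] False by simp
  qed
  have "- ?E n 0 - n * measure (gauss h) {y. \<bar>y\<bar> > 1}
     \<le> (\<integral>\<omega>. - ?E 0 (S n \<omega>) * indicator (alive {- a..} n) \<omega> \<partial>M)"
    by (rule stopped_walk_bound[where C=1 and u="\<lambda>m x. - ?E m x"])
      (use m bd assms h_pos over in auto)
  \<comment> \<open>A surviving walk ends at or above \<open>- a\<close>, strictly above the moved
    barrier, so the sign there is exactly \<open>1\<close>.\<close>
  also have "\<dots> = (\<integral>\<omega>. - indicator (alive {- a..} n) \<omega> \<partial>M)"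
    by (rule Bochner_Integration.integral_cong) (auto simp: alive_def sgn_if split: split_indicator)
  finally have "prob (alive {- a..} n) \<le> ?E n 0 + n * measure (gauss h) {y. \<bar>y\<bar> > 1}"
    by simp
  moreover have "?E n 0 \<le> measure (gauss (n * h)) {y. \<bar>y\<bar> \<le> a + 1}"
  proof (subst walk_mean_eq)
    show "(\<integral>y. ?f y \<partial>gauss (n * h)) \<le> measure (gauss (n * h)) {y. \<bar>y\<bar> \<le> a + 1}"
      using n_pos h_pos assms by (intro gauss_sgn_bounds) auto
  qed (auto simp: sgn_if)
  moreover have "n * measure (gauss h) {y. \<bar>y\<bar> > 1} \<le> n * (3 * h\<^sup>2)"
    using gauss_tail[OF h_pos, of 1] by (intro mult_left_mono) auto
  ultimately show ?thesis by linarith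
qed

text \<open>
  Uses the eigenfunction \<open>cos (pi * x / (2 * \<rho>))\<close>, which is nonpositive for \<open>\<rho> \<le> \<bar>x\<bar> \<le> 3 * \<rho>\<close>, so that only
  steps longer than \<open>2 * \<rho>\<close> do harm.
\<close>
lemma interval_lower:
  assumes "\<rho> > 0"
  shows "exp (- ((pi / (2 * \<rho>))\<^sup>2 * (n * h) / 2)) - n * (3 * h\<^sup>2 / (2 * \<rho>) ^ 4)
    \<le> prob (alive {- \<rho>..\<rho>} n)"
proof -
  define l where "l = pi / (2 * \<rho>)"
  \<comment> \<open>The factor by which one step multiplies \<open>cos (l * x)\<close> on average;
    the sine term of the addition formula integrates to zero by symmetry. The frequency
    \<open>l\<close> puts the zeros of the cosine nearest to the origin at \<open>\<rho>\<close> and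
    \<open>- \<rho>\<close>.\<close>
  define q where "q = exp (- (l\<^sup>2 * h / 2))"
  define u where "u = (\<lambda>(m::nat) x. q ^ m * cos (l * x))"
  interpret \<mu>: prob_space "gauss h" by (rule prob_space_gauss) (rule h_pos)
  have l: "l > 0" "l * \<rho> = pi / 2" using assms by (auto simp: l_def)
  have q: "0 < q" "q \<le> 1" using h_pos by (auto simp: q_def)
  have bd: "\<bar>u m x\<bar> \<le> 1" for m x
    using q by (auto simp: u_def abs_mult intro!: mult_le_one power_le_one)
  have [measurable]: "S n \<in> borel_measurable M" "alive {- \<rho>..\<rho>} n \<in> sets M" by auto
  have sin0: "(\<integral>y. sin (l * y) \<partial>gauss h) = 0"
    using integral_gauss_uminus[of "\<lambda>y. sin (l * y)" h] by simp
  have harm: "u (Suc m) x = (\<integral>y. u m (x + y) \<partial>gauss h)" for m x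
  proof -
    have i: "integrable (gauss h) (\<lambda>y. cos (l * y))" "integrable (gauss h) (\<lambda>y. sin (l * y))"
      by (rule \<mu>.integrable_const_bound[where B=1], auto)+
    have "(\<integral>y. u m (x + y) \<partial>gauss h)
      = (\<integral>y. q ^ m * cos (l * x) * cos (l * y) - q ^ m * sin (l * x) * sin (l * y) \<partial>gauss h)"
      by (simp add: u_def distrib_left cos_add right_diff_distrib mult_ac)
    also have "\<dots> = q ^ m * cos (l * x) * q"
      using i by (simp add: sin0 integral_cos_gauss[OF h_pos] q_def)
    finally have "(\<integral>y. u m (x + y) \<partial>gauss h) = q ^ m * cos (l * x) * q" .
    moreover have "u (Suc m) x = q ^ m * cos (l * x) * q" by (simp add: u_def)
    ultimately show ?thesis by simp
  qed
  have over: "u m (x + y) \<le> indicator {y. \<bar>y\<bar> > 2 * \<rho>} y"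
    if "x \<in> {- \<rho>..\<rho>}" "x + y \<notin> {- \<rho>..\<rho>}" for m x y
  proof (cases "\<bar>y\<bar> > 2 * \<rho>")
    case True
    then show ?thesis using bd[of m "x + y"] by simp
  next
    case False
    define z where "z = \<bar>x + y\<bar>"
    have z: "\<rho> \<le> z" "z \<le> 3 * \<rho>" using that False by (auto simp: z_def)
    have "l * \<rho> \<le> l * z" "l * z \<le> l * (3 * \<rho>)"
      using z l by auto
    moreover have "l * (3 * \<rho>) = 3 * (pi / 2)" using l(2) by (simp add: mult_ac)
    ultimately have "pi / 2 \<le> l * z" "l * z \<le> 3 * (pi / 2)" using l(2) by linarith+
    \<comment> \<open>Subtracting \<open>pi\<close> moves the range from \<open>pi / 2\<close> to
      \<open>3 * (pi / 2)\<close> onto the interval around \<open>0\<close> where the cosine is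
      nonnegative, at the cost of a sign.\<close>
    then have "0 \<le> cos (l * z - pi)" by (intro cos_ge_zero) auto
    then have "cos (l * z) \<le> 0" by simp
    moreover have "cos (l * z) = cos (l * (x + y))"
      by (cases "x + y \<ge> 0") (auto simp: z_def simp flip: mult_minus_right[of l] cos_minus[of "l * (x + y)"])
    ultimately show ?thesis using False q by (simp add: u_def mult_nonneg_nonpos)
  qed
  have "u n 0 - n * measure (gauss h) {y. \<bar>y\<bar> > 2 * \<rho>}
     \<le> (\<integral>\<omega>. u 0 (S n \<omega>) * indicator (alive {- \<rho>..\<rho>} n) \<omega> \<partial>M)"
    by (rule stopped_walk_bound[where C=1]) (use bd assms harm over in \<open>auto simp: u_def\<close>)
  also have "\<dots> \<le> (\<integral>\<omega>. indicator (alive {- \<rho>..\<rho>} n) \<omega> \<partial>M)"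
    by (intro integral_mono integrable_const_bound[where B=1])
      (auto simp: u_def split: split_indicator)
  also have "\<dots> = prob (alive {- \<rho>..\<rho>} n)" by simp
  finally have "u n 0 - n * measure (gauss h) {y. \<bar>y\<bar> > 2 * \<rho>} \<le> prob (alive {- \<rho>..\<rho>} n)" .
  moreover have "n * measure (gauss h) {y. \<bar>y\<bar> > 2 * \<rho>} \<le> n * (3 * h\<^sup>2 / (2 * \<rho>) ^ 4)"
    using gauss_tail[OF h_pos, of "2 * \<rho>"] assms by (intro mult_left_mono) auto
  moreover have "u n 0 = exp (- (l\<^sup>2 * (n * h) / 2))"
    by (simp add: u_def q_def exp_of_nat_mult[symmetric] algebra_simps)
  ultimately show ?thesis unfolding l_def by linarith
qed

end

subsection \<open>Rotation of planar Gaussian increments\<close>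

text \<open>For \<open>c \<noteq> 0\<close> the rotation is carried out by two one-dimensional
  affine substitutions, \<open>u = c * x + s * y\<close> for fixed \<open>y\<close> and then
  \<open>v = (y - s * u) / c\<close> for fixed \<open>u\<close>. Their factors
  \<open>\<bar>c\<bar>\<close> appear on opposite sides and cancel.\<close>

lemma nn_integral_lborel_rotation:
  fixes K :: "real \<times> real \<Rightarrow> ennreal" and c s :: real
  assumes cs: "c\<^sup>2 + s\<^sup>2 = 1" and K [measurable]: "K \<in> borel_measurable (borel \<Otimes>\<^sub>M borel)"
  shows "(\<integral>\<^sup>+x. \<integral>\<^sup>+y. K (c * x + s * y, c * y - s * x) \<partial>lborel \<partial>lborel) = (\<integral>\<^sup>+u. \<integral>\<^sup>+v. K (u, v) \<partial>lborel \<partial>lborel)"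
    (is "?L = ?R")
proof -
  have L: "?L = (\<integral>\<^sup>+y. \<integral>\<^sup>+x. K (c * x + s * y, c * y - s * x) \<partial>lborel \<partial>lborel)"
    using lborel_pair.Fubini'[of "\<lambda>x y. K (c * x + s * y, c * y - s * x)"] by simp
  show ?thesis
  proof (cases "c = 0")
    case False
    \<comment> \<open>After the first substitution the second rotated coordinate has to be expressed
      through \<open>u\<close> and \<open>y\<close>; this is where
      \<open>c\<^sup>2 + s\<^sup>2 = 1\<close> enters.\<close>
    have sc: "(y - s * (s * y + c * x)) / c = c * y - s * x" for x y
    proof -
      have "y - s * (s * y + c * x) = (1 - s\<^sup>2) * y - c * s * x"
        by (simp add: algebra_simps power2_eq_square)
      also have "1 - s\<^sup>2 = c\<^sup>2" using cs by simp
      finally show ?thesis using False by (simp add: field_simps power2_eq_square)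
    qed
    have "ennreal \<bar>c\<bar> * ?L = (\<integral>\<^sup>+y. ennreal \<bar>c\<bar> * (\<integral>\<^sup>+x. K (c * x + s * y, c * y - s * x) \<partial>lborel) \<partial>lborel)"
      unfolding L by (rule nn_integral_cmult[symmetric]) measurable
    also have "\<dots> = (\<integral>\<^sup>+y. (\<integral>\<^sup>+u. K (u, (y - s * u) / c) \<partial>lborel) \<partial>lborel)"
    proof (rule nn_integral_cong)
      fix y
      show "ennreal \<bar>c\<bar> * (\<integral>\<^sup>+x. K (c * x + s * y, c * y - s * x) \<partial>lborel) = (\<integral>\<^sup>+u. K (u, (y - s * u) / c) \<partial>lborel)"
        using nn_integral_real_affine[of "\<lambda>u. K (u, (y - s * u) / c)" c "s * y"] False
        by (simp add: sc[simplified add.commute[of "s * _"]] add.commute[of "s * y"])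
    qed
    also have "\<dots> = (\<integral>\<^sup>+u. (\<integral>\<^sup>+y. K (u, (y - s * u) / c) \<partial>lborel) \<partial>lborel)"
      using lborel_pair.Fubini'[of "\<lambda>u y. K (u, (y - s * u) / c)"] by simp
    also have "\<dots> = (\<integral>\<^sup>+u. ennreal \<bar>c\<bar> * (\<integral>\<^sup>+v. K (u, v) \<partial>lborel) \<partial>lborel)"
    proof (rule nn_integral_cong)
      fix u
      show "(\<integral>\<^sup>+y. K (u, (y - s * u) / c) \<partial>lborel) = ennreal \<bar>c\<bar> * (\<integral>\<^sup>+v. K (u, v) \<partial>lborel)"
        using nn_integral_real_affine[of "\<lambda>y. K (u, (y - s * u) / c)" c "s * u"] False
        by simp
    qed
    also have "\<dots> = ennreal \<bar>c\<bar> * ?R" by (rule nn_integral_cmult) measurable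
    finally show ?thesis using False by (simp add: ennreal_mult_cancel_left)
  next
    \<comment> \<open>A quarter turn: now \<open>s\<close> is \<open>1\<close> or \<open>- 1\<close>
      and the variables separate, so a sign change in each variable suffices.\<close>
    case True
    then have s: "\<bar>s\<bar> = 1" "s \<noteq> 0" using cs by (auto simp: power2_eq_1_iff)
    have "?L = (\<integral>\<^sup>+y. \<integral>\<^sup>+x. K (s * y, - s * x) \<partial>lborel \<partial>lborel)"
      unfolding L using True by simp
    also have "\<dots> = (\<integral>\<^sup>+y. \<integral>\<^sup>+v. K (s * y, v) \<partial>lborel \<partial>lborel)"
    proof (rule nn_integral_cong)
      fix y
      show "(\<integral>\<^sup>+x. K (s * y, - s * x) \<partial>lborel) = (\<integral>\<^sup>+v. K (s * y, v) \<partial>lborel)"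
        using nn_integral_real_affine[of "\<lambda>v. K (s * y, v)" "- s" 0] s by simp
    qed
    also have "\<dots> = ?R"
      using nn_integral_real_affine[of "\<lambda>u. \<integral>\<^sup>+v. K (u, v) \<partial>lborel" s 0] s by simp
    finally show ?thesis .
  qed
qed

text \<open>The product of the two densities depends only on \<open>x\<^sup>2 + y\<^sup>2\<close>,
  which the rotation preserves; the rest is rotation invariance of Lebesgue measure.\<close>

lemma nn_integral_gauss_rotation:
  fixes F :: "real \<times> real \<Rightarrow> ennreal" and c s :: real
  assumes cs: "c\<^sup>2 + s\<^sup>2 = 1" and "h > 0" and F [measurable]: "F \<in> borel_measurable (borel \<Otimes>\<^sub>M borel)"
  shows "(\<integral>\<^sup>+x. \<integral>\<^sup>+y. F (c * x + s * y, c * y - s * x) \<partial>gauss h \<partial>gauss h) = (\<integral>\<^sup>+u. \<integral>\<^sup>+v. F (u, v) \<partial>gauss h \<partial>gauss h)"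
proof -
  define g where "g = (\<lambda>x. ennreal (normal_density 0 (sqrt h) x))"
  have [measurable]: "g \<in> borel_measurable borel" unfolding g_def by simp
  define K where "K = (\<lambda>(u, v). g u * g v * F (u, v))"
  have [measurable]: "K \<in> borel_measurable (borel \<Otimes>\<^sub>M borel)" unfolding K_def by measurable
  have sf: "sigma_finite_measure (gauss h)" by (intro prob_space_imp_sigma_finite prob_space_gauss) fact
  interpret sigma_finite_measure "gauss h" by fact
  have rot: "g x * g y = g (c * x + s * y) * g (c * y - s * x)" for x y
  proof -
    have "(c * x + s * y)\<^sup>2 + (c * y - s * x)\<^sup>2 = (c\<^sup>2 + s\<^sup>2) * (x\<^sup>2 + y\<^sup>2)"
      by (simp add: power2_eq_square algebra_simps)
    then have "(c * x + s * y)\<^sup>2 + (c * y - s * x)\<^sup>2 = x\<^sup>2 + y\<^sup>2" using cs by simp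
    then have "- x\<^sup>2 / (2 * (sqrt h)\<^sup>2) + - y\<^sup>2 / (2 * (sqrt h)\<^sup>2)
        = - (c * x + s * y)\<^sup>2 / (2 * (sqrt h)\<^sup>2) + - (c * y - s * x)\<^sup>2 / (2 * (sqrt h)\<^sup>2)"
      unfolding add_divide_distrib[symmetric] by simp
    then show ?thesis
      by (simp add: g_def normal_density_def ennreal_mult[symmetric] exp_add[symmetric])
  qed
  have eq: "(\<integral>\<^sup>+x. \<integral>\<^sup>+y. G (x, y) \<partial>gauss h \<partial>gauss h) = (\<integral>\<^sup>+x. \<integral>\<^sup>+y. g x * g y * G (x, y) \<partial>lborel \<partial>lborel)"
    if [measurable]: "G \<in> borel_measurable (borel \<Otimes>\<^sub>M borel)" for G
  proof -
    have "(\<integral>\<^sup>+x. \<integral>\<^sup>+y. G (x, y) \<partial>gauss h \<partial>gauss h) = (\<integral>\<^sup>+x. g x * (\<integral>\<^sup>+y. G (x, y) \<partial>gauss h) \<partial>lborel)"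
      by (subst gauss_def, subst nn_integral_density) (auto simp: g_def)
    also have "\<dots> = (\<integral>\<^sup>+x. g x * (\<integral>\<^sup>+y. g y * G (x, y) \<partial>lborel) \<partial>lborel)"
      by (rule nn_integral_cong, subst gauss_def, subst nn_integral_density) (auto simp: g_def)
    also have "\<dots> = (\<integral>\<^sup>+x. \<integral>\<^sup>+y. g x * g y * G (x, y) \<partial>lborel \<partial>lborel)"
      by (intro nn_integral_cong, subst nn_integral_cmult[symmetric]) (auto simp: mult_ac)
    finally show ?thesis .
  qed
  have "(\<integral>\<^sup>+x. \<integral>\<^sup>+y. F (c * x + s * y, c * y - s * x) \<partial>gauss h \<partial>gauss h)
     = (\<integral>\<^sup>+x. \<integral>\<^sup>+y. K (c * x + s * y, c * y - s * x) \<partial>lborel \<partial>lborel)"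
    using eq[of "\<lambda>(x, y). F (c * x + s * y, c * y - s * x)"] by (simp add: K_def rot[symmetric])
  also have "\<dots> = (\<integral>\<^sup>+u. \<integral>\<^sup>+v. K (u, v) \<partial>lborel \<partial>lborel)"
    by (rule nn_integral_lborel_rotation) (use cs in auto)
  also have "\<dots> = (\<integral>\<^sup>+u. \<integral>\<^sup>+v. F (u, v) \<partial>gauss h \<partial>gauss h)"
    using eq[of F] by (simp add: K_def)
  finally show ?thesis .
qed

section \<open>Laws and independence of the rotated increments\<close>

lemma (in prob_space) indep_vars_borelI:
  assumes I: "finite I" "I \<noteq> {}" and rv: "\<And>i. i \<in> I \<Longrightarrow> random_variable borel (X i)"
    and eq: "\<And>A. (\<And>i. i \<in> I \<Longrightarrow> A i \<in> sets borel) \<Longrightarrow>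
      prob {\<omega> \<in> space M. \<forall>i\<in>I. X i \<omega> \<in> A i} = (\<Prod>i\<in>I. prob {\<omega> \<in> space M. X i \<omega> \<in> A i})"
  shows "indep_vars (\<lambda>_. borel :: 'b::topological_space measure) X I"
proof (subst indep_vars_finite[where E="\<lambda>_. sets borel"])
  show "\<forall>A\<in>I \<rightarrow> sets borel. prob (\<Inter>j\<in>I. X j -` A j \<inter> space M) = (\<Prod>j\<in>I. prob (X j -` A j \<inter> space M))"
  proof
    fix A assume "A \<in> I \<rightarrow> sets (borel :: 'b measure)"
    moreover have "(\<Inter>j\<in>I. X j -` A j \<inter> space M) = {\<omega> \<in> space M. \<forall>i\<in>I. X i \<omega> \<in> A i}"
      using I by auto
    moreover have "X j -` A j \<inter> space M = {\<omega> \<in> space M. X j \<omega> \<in> A j}" for j by auto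
    ultimately show "prob (\<Inter>j\<in>I. X j -` A j \<inter> space M) = (\<Prod>j\<in>I. prob (X j -` A j \<inter> space M))"
      using eq[of A] by auto
  qed
next
  fix i assume "i \<in> I"
  show "sets (borel :: 'b measure) = sigma_sets (space borel) (sets borel)"
    by (rule sets.sigma_sets_eq[symmetric])
  show "sets (borel :: 'b measure) \<subseteq> Pow (space borel)" by (rule sets.space_closed)
  show "Int_stable (sets (borel :: 'b measure))" by (rule sets.Int_stable)
  show "space (borel :: 'b measure) \<in> sets borel" by (rule sets.top)
  show "random_variable borel (X i)" by (rule rv) fact
qed (fact I)+

text \<open>Isolates what the grid estimates take from planar Brownian motion: Gaussian increments,
  independent within each coordinate, with the two increment vectors independent of each
  other.\<close>

locale planar_gauss_steps = prob_space M for M :: "'a measure" +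
  fixes X Y :: "nat \<Rightarrow> 'a \<Rightarrow> real" and n :: nat and h :: real
  assumes n: "n > 0" and h: "h > 0"
    and indep_X: "indep_vars (\<lambda>_. borel) X {..<n}" and indep_Y: "indep_vars (\<lambda>_. borel) Y {..<n}"
    and distr_X: "i < n \<Longrightarrow> distr M borel (X i) = gauss h" and distr_Y: "i < n \<Longrightarrow> distr M borel (Y i) = gauss h"
    and indep_XY: "indep_var (PiM {..<n} (\<lambda>_. borel)) (\<lambda>\<omega>. \<lambda>i\<in>{..<n}. X i \<omega>)
                             (PiM {..<n} (\<lambda>_. borel)) (\<lambda>\<omega>. \<lambda>i\<in>{..<n}. Y i \<omega>)"
begin

lemma rv_XY [measurable]: "i < n \<Longrightarrow> X i \<in> borel_measurable M" "i < n \<Longrightarrow> Y i \<in> borel_measurable M"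
  using indep_X indep_Y by (auto simp: indep_vars_def)

lemma joint_law:
  "distr M (PiM {..<n} (\<lambda>_. borel) \<Otimes>\<^sub>M PiM {..<n} (\<lambda>_. borel)) (\<lambda>\<omega>. (\<lambda>i\<in>{..<n}. X i \<omega>, \<lambda>i\<in>{..<n}. Y i \<omega>))
    = PiM {..<n} (\<lambda>_. gauss h) \<Otimes>\<^sub>M PiM {..<n} (\<lambda>_. gauss h)"
proof -
  have "distr M (PiM {..<n} (\<lambda>_. borel)) (\<lambda>\<omega>. \<lambda>i\<in>{..<n}. X i \<omega>) = PiM {..<n} (\<lambda>i. distr M borel (X i))"
    "distr M (PiM {..<n} (\<lambda>_. borel)) (\<lambda>\<omega>. \<lambda>i\<in>{..<n}. Y i \<omega>) = PiM {..<n} (\<lambda>i. distr M borel (Y i))"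
    using n by (auto intro!: indep_vars_iff_distr_eq_PiM'[THEN iffD1] indep_X indep_Y)
  moreover have "PiM {..<n} (\<lambda>i. distr M borel (X i)) = PiM {..<n} (\<lambda>_. gauss h)"
    "PiM {..<n} (\<lambda>i. distr M borel (Y i)) = PiM {..<n} (\<lambda>_. gauss h)"
    by (intro PiM_cong refl distr_X distr_Y; simp)+
  ultimately show ?thesis
    using indep_XY unfolding indep_var_distribution_eq by simp
qed

text \<open>Under the product law the integral over all increments factors into integrals over the
  pairs \<open>(x i, y i)\<close>, and each pair is invariant under rotation. Taking some sets equal
  to \<open>UNIV\<close> recovers every marginal statement, so this formula determines the joint law
  of both rotated walks.\<close>

lemma rotated_box:
  assumes cs: "c\<^sup>2 + s\<^sup>2 = 1"
    and A: "\<And>i. i < n \<Longrightarrow> A i \<in> sets borel" and B: "\<And>i. i < n \<Longrightarrow> B i \<in> sets borel"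
  shows "prob {\<omega> \<in> space M. \<forall>i<n. c * X i \<omega> + s * Y i \<omega> \<in> A i \<and> c * Y i \<omega> - s * X i \<omega> \<in> B i}
    = (\<Prod>i<n. measure (gauss h) (A i) * measure (gauss h) (B i))"
proof -
  let ?P = "PiM {..<n} (\<lambda>_. gauss h)" and ?Q = "PiM {..<n} (\<lambda>_. borel :: real measure)"
  define f where "f i = (\<lambda>(x, y). indicator (A i) (c * x + s * y) * indicator (B i) (c * y - s * x) :: ennreal)" for i
  have f [measurable]: "f i \<in> borel_measurable (borel \<Otimes>\<^sub>M borel)" if "i < n" for i
  proof -
    note [measurable] = A[OF that] B[OF that]
    show ?thesis unfolding f_def by measurable
  qed
  have f1: "(\<lambda>y. f i (x, y)) \<in> borel_measurable borel" if "i < n" for i x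
    using f[OF that] by measurable
  interpret G: prob_space "gauss h" by (rule prob_space_gauss) (rule h)
  interpret PS: product_sigma_finite "\<lambda>_. gauss h" by standard
  interpret PP: prob_space ?P by (rule prob_space_PiM) (rule G.prob_space_axioms)
  have f2: "(\<lambda>x. \<integral>\<^sup>+y. f i (x, y) \<partial>gauss h) \<in> borel_measurable borel" if "i < n" for i
    using f[OF that] by measurable
  have sPQ: "sets (?P \<Otimes>\<^sub>M ?P) = sets (?Q \<Otimes>\<^sub>M ?Q)"
    by (intro sets_pair_measure_cong sets_PiM_cong) auto
  have fm: "(\<lambda>z. \<Prod>i<n. f i (fst z i, snd z i)) \<in> borel_measurable (?Q \<Otimes>\<^sub>M ?Q)"
  proof (rule borel_measurable_prod_ennreal)
    fix i assume "i \<in> {..<n}"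
    then have i: "i < n" by simp
    have [measurable]: "(\<lambda>x. x i) \<in> borel_measurable ?Q" using i by simp
    show "(\<lambda>z. f i (fst z i, snd z i)) \<in> borel_measurable (?Q \<Otimes>\<^sub>M ?Q)"
      by (rule measurable_compose[OF _ f[OF i]]) measurable
  qed
  have XYm: "(\<lambda>\<omega>. (\<lambda>i\<in>{..<n}. X i \<omega>, \<lambda>i\<in>{..<n}. Y i \<omega>)) \<in> measurable M (?Q \<Otimes>\<^sub>M ?Q)"
    by (intro measurable_Pair measurable_restrict) auto
  let ?E = "{\<omega> \<in> space M. \<forall>i<n. c * X i \<omega> + s * Y i \<omega> \<in> A i \<and> c * Y i \<omega> - s * X i \<omega> \<in> B i}"
  have "?E = space M \<inter> (\<Inter>i\<in>{..<n}. {\<omega> \<in> space M. c * X i \<omega> + s * Y i \<omega> \<in> A i \<and> c * Y i \<omega> - s * X i \<omega> \<in> B i})"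
    using n by auto
  also have "\<dots> \<in> sets M"
  proof (intro sets.Int sets.top sets.finite_INT)
    fix i assume "i \<in> {..<n}"
    then have i: "i < n" by simp
    note [measurable] = A[OF i] B[OF i] rv_XY[OF i]
    show "{\<omega> \<in> space M. c * X i \<omega> + s * Y i \<omega> \<in> A i \<and> c * Y i \<omega> - s * X i \<omega> \<in> B i} \<in> sets M"
      by measurable
  qed (use n in auto)
  finally have E: "?E \<in> sets M" .
  have "emeasure M ?E = (\<integral>\<^sup>+\<omega>. indicator ?E \<omega> \<partial>M)"
    by (rule nn_integral_indicator[OF E, symmetric])
  also have "\<dots> = (\<integral>\<^sup>+\<omega>. (\<Prod>i<n. f i (X i \<omega>, Y i \<omega>)) \<partial>M)"
  proof (rule nn_integral_cong)
    fix \<omega> assume "\<omega> \<in> space M"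
    then show "indicator ?E \<omega> = (\<Prod>i<n. f i (X i \<omega>, Y i \<omega>))"
    proof (cases "\<omega> \<in> ?E")
      case True
      then have "f i (X i \<omega>, Y i \<omega>) = 1" if "i < n" for i using that by (simp add: f_def)
      then show ?thesis using True by simp
    next
      case False
      then obtain i where "i < n" "f i (X i \<omega>, Y i \<omega>) = 0"
        using \<open>\<omega> \<in> space M\<close> by (auto simp: f_def)
      then have "(\<Prod>i<n. f i (X i \<omega>, Y i \<omega>)) = 0" by (intro prod_zero) auto
      then show ?thesis using False by simp
    qed
  qed
  also have "\<dots> = (\<integral>\<^sup>+z. (\<Prod>i<n. f i (fst z i, snd z i)) \<partial>(?P \<Otimes>\<^sub>M ?P))"
    unfolding joint_law[symmetric] using fm XYm by (subst nn_integral_distr) auto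
  also have "\<dots> = (\<integral>\<^sup>+x. \<integral>\<^sup>+y. (\<Prod>i<n. f i (x i, y i)) \<partial>?P \<partial>?P)"
    using fm by (subst PP.nn_integral_fst[symmetric]) (auto simp: measurable_cong_sets[OF sPQ refl])
  \<comment> \<open>The product over \<open>i\<close> is pulled out of the inner integral here and
    out of the outer one next, which leaves one double integral per index.\<close>
  also have "\<dots> = (\<integral>\<^sup>+x. (\<Prod>i<n. \<integral>\<^sup>+y. f i (x i, y) \<partial>gauss h) \<partial>?P)"
    by (intro nn_integral_cong PS.product_nn_integral_prod) (use f1 in auto)
  also have "\<dots> = (\<Prod>i<n. \<integral>\<^sup>+x. \<integral>\<^sup>+y. f i (x, y) \<partial>gauss h \<partial>gauss h)"
    by (intro PS.product_nn_integral_prod) (use f2 in auto)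
  also have "\<dots> = (\<Prod>i<n. emeasure (gauss h) (A i) * emeasure (gauss h) (B i))"
  proof (rule prod.cong)
    fix i assume "i \<in> {..<n}"
    then have i: "i < n" by simp
    note [measurable] = A[OF i] B[OF i]
    let ?F = "\<lambda>z. indicator (A i) (fst z) * indicator (B i) (snd z) :: ennreal"
    have "?F \<in> borel_measurable (borel \<Otimes>\<^sub>M borel)" by measurable
    from nn_integral_gauss_rotation[OF cs h this]
    have "(\<integral>\<^sup>+x. \<integral>\<^sup>+y. f i (x, y) \<partial>gauss h \<partial>gauss h)
      = (\<integral>\<^sup>+u. \<integral>\<^sup>+v. indicator (A i) u * indicator (B i) v \<partial>gauss h \<partial>gauss h)"
      unfolding f_def split fst_conv snd_conv .
    also have "\<dots> = (\<integral>\<^sup>+u. indicator (A i) u * emeasure (gauss h) (B i) \<partial>gauss h)"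
      by (intro nn_integral_cong, subst nn_integral_cmult) auto
    also have "\<dots> = emeasure (gauss h) (A i) * emeasure (gauss h) (B i)"
      by (subst nn_integral_multc) auto
    finally show "(\<integral>\<^sup>+x. \<integral>\<^sup>+y. f i (x, y) \<partial>gauss h \<partial>gauss h) = emeasure (gauss h) (A i) * emeasure (gauss h) (B i)" .
  qed simp
  also have "\<dots> = ennreal (\<Prod>i<n. measure (gauss h) (A i) * measure (gauss h) (B i))"
    by (simp add: G.emeasure_eq_measure ennreal_mult[symmetric] prod_ennreal)
  finally show ?thesis
    by (simp add: emeasure_eq_measure prod_nonneg)
qed

lemma rotated_marginals:
  assumes cs: "c\<^sup>2 + s\<^sup>2 = 1" and i: "i < n" and A [measurable]: "A \<in> sets borel"
  shows "prob {\<omega> \<in> space M. c * X i \<omega> + s * Y i \<omega> \<in> A} = measure (gauss h) A"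
    and "prob {\<omega> \<in> space M. c * Y i \<omega> - s * X i \<omega> \<in> A} = measure (gauss h) A"
proof -
  interpret G: prob_space "gauss h" by (rule prob_space_gauss) (rule h)
  have U: "measure (gauss h) UNIV = 1" using G.prob_space by simp
  let ?C = "\<lambda>j. if j = i then A else UNIV"
  have pr: "(\<Prod>j<n. measure (gauss h) (?C j)) = measure (gauss h) A"
    using i by (simp add: if_distrib[of "measure (gauss h)"] U prod.delta cong: if_cong)
  have e: "{\<omega> \<in> space M. \<forall>j<n. c * X j \<omega> + s * Y j \<omega> \<in> ?C j \<and> c * Y j \<omega> - s * X j \<omega> \<in> UNIV}
      = {\<omega> \<in> space M. c * X i \<omega> + s * Y i \<omega> \<in> A}"
    "{\<omega> \<in> space M. \<forall>j<n. c * X j \<omega> + s * Y j \<omega> \<in> UNIV \<and> c * Y j \<omega> - s * X j \<omega> \<in> ?C j}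
      = {\<omega> \<in> space M. c * Y i \<omega> - s * X i \<omega> \<in> A}"
    using i by auto
  show "prob {\<omega> \<in> space M. c * X i \<omega> + s * Y i \<omega> \<in> A} = measure (gauss h) A"
    using rotated_box[OF cs, of ?C "\<lambda>_. UNIV"] unfolding e by (simp add: U pr)
  show "prob {\<omega> \<in> space M. c * Y i \<omega> - s * X i \<omega> \<in> A} = measure (gauss h) A"
    using rotated_box[OF cs, of "\<lambda>_. UNIV" ?C] unfolding e by (simp add: U pr)
qed

lemma rotated_distr:
  assumes cs: "c\<^sup>2 + s\<^sup>2 = 1" and i: "i < n"
  shows "distr M borel (\<lambda>\<omega>. c * X i \<omega> + s * Y i \<omega>) = gauss h"
    and "distr M borel (\<lambda>\<omega>. c * Y i \<omega> - s * X i \<omega>) = gauss h"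
proof -
  interpret G: prob_space "gauss h" by (rule prob_space_gauss) (rule h)
  note [measurable] = rv_XY[OF i]
  have v: "f -` A \<inter> space M = {\<omega> \<in> space M. f \<omega> \<in> A}" for A and f :: "'a \<Rightarrow> real" by auto
  show "distr M borel (\<lambda>\<omega>. c * X i \<omega> + s * Y i \<omega>) = gauss h"
    by (rule measure_eqI)
      (auto simp: emeasure_distr v emeasure_eq_measure G.emeasure_eq_measure rotated_marginals[OF cs i])
  show "distr M borel (\<lambda>\<omega>. c * Y i \<omega> - s * X i \<omega>) = gauss h"
    by (rule measure_eqI)
      (auto simp: emeasure_distr v emeasure_eq_measure G.emeasure_eq_measure rotated_marginals[OF cs i])
qed

lemma rotated_walk:
  assumes cs: "c\<^sup>2 + s\<^sup>2 = 1"
  shows "gauss_walk M (\<lambda>i \<omega>. c * X i \<omega> + s * Y i \<omega>) n h"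
    and "gauss_walk M (\<lambda>i \<omega>. c * Y i \<omega> - s * X i \<omega>) n h"
proof -
  interpret G: prob_space "gauss h" by (rule prob_space_gauss) (rule h)
  have U: "measure (gauss h) UNIV = 1" using G.prob_space by simp
  have "indep_vars (\<lambda>_. borel) (\<lambda>i \<omega>. c * X i \<omega> + s * Y i \<omega>) {..<n}"
  proof (rule indep_vars_borelI)
    fix A :: "nat \<Rightarrow> real set" assume A: "\<And>i. i \<in> {..<n} \<Longrightarrow> A i \<in> sets borel"
    show "prob {\<omega> \<in> space M. \<forall>i\<in>{..<n}. c * X i \<omega> + s * Y i \<omega> \<in> A i} =
      (\<Prod>i<n. prob {\<omega> \<in> space M. c * X i \<omega> + s * Y i \<omega> \<in> A i})"
      using rotated_box[OF cs, of A "\<lambda>_. UNIV"] A by (simp add: U Ball_def rotated_marginals[OF cs])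
  qed (use n in auto)
  then show "gauss_walk M (\<lambda>i \<omega>. c * X i \<omega> + s * Y i \<omega>) n h"
    using n h by unfold_locales (auto simp: rotated_distr[OF cs] intro: G.prob_space)
  have "indep_vars (\<lambda>_. borel) (\<lambda>i \<omega>. c * Y i \<omega> - s * X i \<omega>) {..<n}"
  proof (rule indep_vars_borelI)
    fix A :: "nat \<Rightarrow> real set" assume A: "\<And>i. i \<in> {..<n} \<Longrightarrow> A i \<in> sets borel"
    show "prob {\<omega> \<in> space M. \<forall>i\<in>{..<n}. c * Y i \<omega> - s * X i \<omega> \<in> A i} =
      (\<Prod>i<n. prob {\<omega> \<in> space M. c * Y i \<omega> - s * X i \<omega> \<in> A i})"
      using rotated_box[OF cs, of "\<lambda>_. UNIV" A] A by (simp add: U Ball_def rotated_marginals[OF cs])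
  qed (use n in auto)
  then show "gauss_walk M (\<lambda>i \<omega>. c * Y i \<omega> - s * X i \<omega>) n h"
    using n h by unfold_locales (auto simp: rotated_distr[OF cs] intro: G.prob_space)
qed

text \<open>Both families are placed in one family indexed by a disjoint sum, so that independence
  of the two walks follows by splitting the index set into its two blocks.\<close>

lemma rotated_indep:
  assumes cs: "c\<^sup>2 + s\<^sup>2 = 1"
  shows "indep_vars (\<lambda>_. borel)
    (case_sum (\<lambda>i \<omega>. c * X i \<omega> + s * Y i \<omega>) (\<lambda>i \<omega>. c * Y i \<omega> - s * X i \<omega>)) ({..<n} <+> {..<n})"
proof (rule indep_vars_borelI)
  let ?\<zeta> = "case_sum (\<lambda>i \<omega>. c * X i \<omega> + s * Y i \<omega>) (\<lambda>i \<omega>. c * Y i \<omega> - s * X i \<omega>)"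
  fix A :: "nat + nat \<Rightarrow> real set" assume A: "\<And>i. i \<in> {..<n} <+> {..<n} \<Longrightarrow> A i \<in> sets borel"
  have "{\<omega> \<in> space M. \<forall>i\<in>{..<n} <+> {..<n}. ?\<zeta> i \<omega> \<in> A i}
    = {\<omega> \<in> space M. \<forall>i<n. c * X i \<omega> + s * Y i \<omega> \<in> A (Inl i) \<and> c * Y i \<omega> - s * X i \<omega> \<in> A (Inr i)}"
    by (auto simp: Plus_def ball_Un)
  then show "prob {\<omega> \<in> space M. \<forall>i\<in>{..<n} <+> {..<n}. ?\<zeta> i \<omega> \<in> A i} =
      (\<Prod>i\<in>{..<n} <+> {..<n}. prob {\<omega> \<in> space M. ?\<zeta> i \<omega> \<in> A i})"
    using A by (simp add: rotated_box[OF cs] prod.Plus rotated_marginals[OF cs] prod.distrib InlI InrI)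
qed (use n in auto)

text \<open>Each survival event is the preimage of a measurable set of increment vectors,
  \<open>E\<close> or \<open>F\<close>, under one of two independent blocks of coordinates.\<close>

lemma rotated_alive_product:
  assumes cs: "c\<^sup>2 + s\<^sup>2 = 1" and [measurable]: "I \<in> sets borel" "J \<in> sets borel"
  shows "prob (iid_walk.alive M (\<lambda>i \<omega>. c * X i \<omega> + s * Y i \<omega>) I n \<inter> iid_walk.alive M (\<lambda>i \<omega>. c * Y i \<omega> - s * X i \<omega>) J n)
    = prob (iid_walk.alive M (\<lambda>i \<omega>. c * X i \<omega> + s * Y i \<omega>) I n) * prob (iid_walk.alive M (\<lambda>i \<omega>. c * Y i \<omega> - s * X i \<omega>) J n)"
proof -
  let ?\<zeta> = "case_sum (\<lambda>i \<omega>. c * X i \<omega> + s * Y i \<omega>) (\<lambda>i \<omega>. c * Y i \<omega> - s * X i \<omega>)"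
  let ?L = "Inl ` {..<n} :: (nat + nat) set" and ?R = "Inr ` {..<n} :: (nat + nat) set"
  interpret A: gauss_walk M "\<lambda>i \<omega>. c * X i \<omega> + s * Y i \<omega>" n h by (rule rotated_walk[OF cs])
  interpret B: gauss_walk M "\<lambda>i \<omega>. c * Y i \<omega> - s * X i \<omega>" n h by (rule rotated_walk[OF cs])
  have iv: "indep_var (PiM ?L (\<lambda>_. borel)) (\<lambda>\<omega>. restrict (\<lambda>i. ?\<zeta> i \<omega>) ?L)
                 (PiM ?R (\<lambda>_. borel)) (\<lambda>\<omega>. restrict (\<lambda>i. ?\<zeta> i \<omega>) ?R)"
    by (rule indep_var_restrict[OF rotated_indep[OF cs]]) auto
  define E :: "(nat + nat \<Rightarrow> real) set" where "E = {x \<in> space (PiM ?L (\<lambda>_. borel)). \<forall>k\<in>{..n}. (\<Sum>i<k. x (Inl i)) \<in> I}"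
  define F :: "(nat + nat \<Rightarrow> real) set" where "F = {x \<in> space (PiM ?R (\<lambda>_. borel)). \<forall>k\<in>{..n}. (\<Sum>i<k. x (Inr i)) \<in> J}"
  have E: "E \<in> sets (PiM ?L (\<lambda>_. borel))"
  proof -
    have "E = (\<Inter>k\<in>{..n}. {x \<in> space (PiM ?L (\<lambda>_. borel)). (\<Sum>i<k. x (Inl i)) \<in> I})"
      unfolding E_def by auto
    also have "\<dots> \<in> sets (PiM ?L (\<lambda>_. borel))"
    proof (rule sets.finite_INT)
      fix k assume k: "k \<in> {..n}"
      have [measurable]: "(\<lambda>x. \<Sum>i<k. x (Inl i)) \<in> borel_measurable (PiM ?L (\<lambda>_. borel :: real measure))"
        by (rule borel_measurable_sum, rule measurable_component_singleton) (use k in auto)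
      show "{x \<in> space (PiM ?L (\<lambda>_. borel)). (\<Sum>i<k. x (Inl i)) \<in> I} \<in> sets (PiM ?L (\<lambda>_. borel))"
        by measurable
    qed auto
    finally show ?thesis .
  qed
  have F: "F \<in> sets (PiM ?R (\<lambda>_. borel))"
  proof -
    have "F = (\<Inter>k\<in>{..n}. {x \<in> space (PiM ?R (\<lambda>_. borel)). (\<Sum>i<k. x (Inr i)) \<in> J})"
      unfolding F_def by auto
    also have "\<dots> \<in> sets (PiM ?R (\<lambda>_. borel))"
    proof (rule sets.finite_INT)
      fix k assume k: "k \<in> {..n}"
      have [measurable]: "(\<lambda>x. \<Sum>i<k. x (Inr i)) \<in> borel_measurable (PiM ?R (\<lambda>_. borel :: real measure))"
        by (rule borel_measurable_sum, rule measurable_component_singleton) (use k in auto)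
      show "{x \<in> space (PiM ?R (\<lambda>_. borel)). (\<Sum>i<k. x (Inr i)) \<in> J} \<in> sets (PiM ?R (\<lambda>_. borel))"
        by measurable
    qed auto
    finally show ?thesis .
  qed
  have a: "A.alive I n = (\<lambda>\<omega>. restrict (\<lambda>i. ?\<zeta> i \<omega>) ?L) -` E \<inter> space M"
    by (auto simp: A.alive_def A.S_def E_def space_PiM)
  have b: "B.alive J n = (\<lambda>\<omega>. restrict (\<lambda>i. ?\<zeta> i \<omega>) ?R) -` F \<inter> space M"
    by (auto simp: B.alive_def B.S_def F_def space_PiM)
  have "A.alive I n \<inter> B.alive J n = (\<lambda>\<omega>. (restrict (\<lambda>i. ?\<zeta> i \<omega>) ?L, restrict (\<lambda>i. ?\<zeta> i \<omega>) ?R)) -` (E \<times> F) \<inter> space M"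
    unfolding a b by auto
  then show ?thesis
    unfolding a b using indep_varD[OF iv E F] by simp
qed

end

text \<open>Rounding up to the next grid point. It does not leave \<open>[0, t]\<close>, since
  \<open>t\<close> is itself a grid point, and it never falls below \<open>s\<close>, so the
  approximations also respect any lower bound on \<open>s\<close>.\<close>

lemma dyadic_approximation_from_above:
  fixes s t :: real
  assumes "0 \<le> s" "s \<le> t" "t > 0"
  obtains k :: "nat \<Rightarrow> nat" where "\<And>m. k m \<le> 2 ^ m" "\<And>m. s \<le> k m * (t / 2 ^ m)"
    "(\<lambda>m. k m * (t / 2 ^ m)) \<longlonglongrightarrow> s"
proof -
  define k where "k m = nat \<lceil>s * 2 ^ m / t\<rceil>" for m :: nat
  have r: "real (k m) = \<lceil>s * 2 ^ m / t\<rceil>" for m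
    using assms by (simp add: k_def)
  have "s * 2 ^ m / t \<le> 2 ^ m" for m :: nat
    using assms by (simp add: field_simps)
  then have "\<lceil>s * 2 ^ m / t\<rceil> \<le> 2 ^ m" for m :: nat
    by (simp add: ceiling_le_iff)
  then have 1: "k m \<le> 2 ^ m" for m
    by (simp add: k_def nat_le_iff)
  have "s * 2 ^ m / t \<le> k m" for m
    unfolding r by (rule le_of_int_ceiling)
  then have 2: "s \<le> k m * (t / 2 ^ m)" for m
    using assms by (simp add: field_simps)
  have "k m \<le> s * 2 ^ m / t + 1" for m
    unfolding r by linarith
  then have 3: "k m * (t / 2 ^ m) \<le> s + t / 2 ^ m" for m
    using assms by (simp add: field_simps)
  have "(\<lambda>m. s + t * (1 / 2) ^ m) \<longlonglongrightarrow> s + t * 0"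
    by (intro tendsto_intros) simp
  then have "(\<lambda>m. s + t / 2 ^ m) \<longlonglongrightarrow> s"
    by (simp add: power_divide)
  then have "(\<lambda>m. k m * (t / 2 ^ m)) \<longlonglongrightarrow> s"
    by (rule tendsto_sandwich[rotated 2, OF tendsto_const]) (use 2 3 in \<open>auto simp del: times_divide_eq_right intro!: always_eventually\<close>)
  with that 1 2 show ?thesis by blast
qed

subsection \<open>Planar Brownian motion along grids and exit times\<close>

context standard_planar_brownian_motion
begin

sublocale Re: standard_brownian_motion M "\<lambda>t \<omega>. Re (Z t \<omega>)" by (rule brownian_Re)
sublocale Im: standard_brownian_motion M "\<lambda>t \<omega>. Im (Z t \<omega>)" by (rule brownian_Im)

lemma Z_measurable [measurable]: "t \<ge> 0 \<Longrightarrow> Z t \<in> borel_measurable M"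
  using Re.random_variable_at[of t] Im.random_variable_at[of t]
  by (simp add: borel_measurable_complex_iff)

lemma Z_continuous: "\<omega> \<in> space M \<Longrightarrow> continuous_on {0..} (\<lambda>t. Z t \<omega>)"
  using continuous_on_Complex[OF Re.continuous_paths[of \<omega>] Im.continuous_paths[of \<omega>]] by simp

lemma Z_start: "AE \<omega> in M. Z 0 \<omega> = 0"
  using Re.start_zero Im.start_zero by eventually_elim (simp add: complex_eq_iff)

lemma planar_steps:
  fixes h :: real
  assumes n: "n > 0" and h: "h > 0"
  shows "planar_gauss_steps M (\<lambda>i \<omega>. Re (Z (Suc i * h) \<omega>) - Re (Z (i * h) \<omega>))
    (\<lambda>i \<omega>. Im (Z (Suc i * h) \<omega>) - Im (Z (i * h) \<omega>)) n h"
proof unfold_locales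
  show "n > 0" "h > 0" by fact+
  show "indep_vars (\<lambda>_. borel) (\<lambda>i \<omega>. Re (Z (Suc i * h) \<omega>) - Re (Z (i * h) \<omega>)) {..<n}"
    using Re.independent_increments[of "\<lambda>i. i * h" n] h by simp
  show "indep_vars (\<lambda>_. borel) (\<lambda>i \<omega>. Im (Z (Suc i * h) \<omega>) - Im (Z (i * h) \<omega>)) {..<n}"
    using Im.independent_increments[of "\<lambda>i. i * h" n] h by simp
  have d: "distr M borel f = gauss h" if "distributed M lborel f (normal_density 0 (sqrt h))" for f
    using that unfolding distributed_def gauss_def by (auto cong: distr_cong)
  have e: "Suc i * h - i * h = h" for i by (simp add: algebra_simps)
  show "distr M borel (\<lambda>\<omega>. Re (Z (Suc i * h) \<omega>) - Re (Z (i * h) \<omega>)) = gauss h" for i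
    using Re.normal_increments[of "i * h" "Suc i * h"] h unfolding e by (intro d) simp
  show "distr M borel (\<lambda>\<omega>. Im (Z (Suc i * h) \<omega>) - Im (Z (i * h) \<omega>)) = gauss h" for i
    using Im.normal_increments[of "i * h" "Suc i * h"] h unfolding e by (intro d) simp
  \<comment> \<open>The increments are a measurable function of the whole coordinate path, so the
    assumed independence of the two paths passes to the increment vectors.\<close>
  let ?g = "\<lambda>x. \<lambda>i\<in>{..<n}. x (Suc i * h) - x (i * h) :: real"
  have g: "?g \<in> measurable (PiM {0..} (\<lambda>_. borel)) (PiM {..<n} (\<lambda>_. borel))"
    by (intro measurable_restrict borel_measurable_diff measurable_component_singleton) (use h in auto)
  have "indep_var (PiM {..<n} (\<lambda>_. borel)) (?g \<circ> (\<lambda>\<omega>. \<lambda>t\<in>{0..}. Re (Z t \<omega>)))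
                 (PiM {..<n} (\<lambda>_. borel)) (?g \<circ> (\<lambda>\<omega>. \<lambda>t\<in>{0..}. Im (Z t \<omega>)))"
    by (rule indep_var_compose[OF independent_Re_Im g g])
  moreover have "?g \<circ> (\<lambda>\<omega>. \<lambda>t\<in>{0..}. f (Z t \<omega>)) = (\<lambda>\<omega>. \<lambda>i\<in>{..<n}. f (Z (Suc i * h) \<omega>) - f (Z (i * h) \<omega>))" for f
    using h by (auto simp: fun_eq_iff restrict_def)
  ultimately show "indep_var (PiM {..<n} (\<lambda>_. borel)) (\<lambda>\<omega>. \<lambda>i\<in>{..<n}. Re (Z (Suc i * h) \<omega>) - Re (Z (i * h) \<omega>))
                 (PiM {..<n} (\<lambda>_. borel)) (\<lambda>\<omega>. \<lambda>i\<in>{..<n}. Im (Z (Suc i * h) \<omega>) - Im (Z (i * h) \<omega>))"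
    by simp
qed

text \<open>
  The imaginary part of \<open>u * z\<close> is obtained as the real part of \<open>- \<i> * u * z\<close>, so that one definition
  serves both rotated coordinates.
\<close>
definition grid_event :: "complex \<Rightarrow> real \<Rightarrow> nat \<Rightarrow> real set \<Rightarrow> 'a set" where
  "grid_event u h n I = {\<omega> \<in> space M. \<forall>k::nat. k \<le> n \<longrightarrow> Re (u * (Z (real k * h) \<omega> - Z 0 \<omega>)) \<in> I}"

text \<open>As in \<open>grid_event\<close>, subtracting \<open>Z 0 \<omega>\<close> leaves only
  increments, so the walk identities hold on every path. That \<open>Z 0\<close> vanishes almost
  surely enters only when these events are compared with \<open>exit_time\<close>.\<close>

definition path_event :: "complex \<Rightarrow> real \<Rightarrow> real set \<Rightarrow> 'a set" where
  "path_event u t I = {\<omega> \<in> space M. \<forall>s\<in>{0..t}. Re (u * (Z s \<omega> - Z 0 \<omega>)) \<in> I}"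

lemma grid_walk:
  assumes "cmod u = 1" "n > 0" "h > 0"
  obtains \<xi> \<eta> where "gauss_walk M \<xi> n h" "gauss_walk M \<eta> n h"
    "\<And>I. grid_event u h n I = iid_walk.alive M \<xi> I n"
    "\<And>J. grid_event (- \<i> * u) h n J = iid_walk.alive M \<eta> J n"
    "\<And>I J. I \<in> sets borel \<Longrightarrow> J \<in> sets borel \<Longrightarrow>
      prob (grid_event u h n I \<inter> grid_event (- \<i> * u) h n J) = prob (grid_event u h n I) * prob (grid_event (- \<i> * u) h n J)"
proof -
  let ?X = "\<lambda>i \<omega>. Re (Z (Suc i * h) \<omega>) - Re (Z (i * h) \<omega>)"
  let ?Y = "\<lambda>i \<omega>. Im (Z (Suc i * h) \<omega>) - Im (Z (i * h) \<omega>)"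
  interpret P: planar_gauss_steps M ?X ?Y n h by (rule planar_steps) fact+
  \<comment> \<open>The sign of \<open>s\<close> makes \<open>Re (u * z)\<close> equal to
    \<open>c * Re z + s * Im z\<close> and \<open>Re (- \<i> * u * z)\<close> equal to
    \<open>c * Im z - s * Re z\<close>.\<close>
  define c where "c = Re u" define s where "s = - Im u"
  have cs: "c\<^sup>2 + s\<^sup>2 = 1" using assms(1) by (simp add: c_def s_def cmod_def)
  let ?\<xi> = "\<lambda>i \<omega>. c * ?X i \<omega> + s * ?Y i \<omega>" and ?\<eta> = "\<lambda>i \<omega>. c * ?Y i \<omega> - s * ?X i \<omega>"
  interpret A: gauss_walk M ?\<xi> n h by (rule P.rotated_walk[OF cs])
  interpret B: gauss_walk M ?\<eta> n h by (rule P.rotated_walk[OF cs])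
  have X: "(\<Sum>i<k. ?X i \<omega>) = Re (Z (k * h) \<omega> - Z 0 \<omega>)" for k \<omega>
    using sum_lessThan_telescope[of "\<lambda>i. Re (Z (i * h) \<omega>)" k] by simp
  have Y: "(\<Sum>i<k. ?Y i \<omega>) = Im (Z (k * h) \<omega> - Z 0 \<omega>)" for k \<omega>
    using sum_lessThan_telescope[of "\<lambda>i. Im (Z (i * h) \<omega>)" k] by simp
  have a: "A.S k \<omega> = Re (u * (Z (k * h) \<omega> - Z 0 \<omega>))" for k \<omega>
    unfolding A.S_def sum.distrib sum_distrib_left[symmetric] X Y by (simp add: c_def s_def)
  have lin: "(\<Sum>i<k. c * p i - s * q i) = c * (\<Sum>i<k. p i) - s * (\<Sum>i<k. q i)" for p q :: "nat \<Rightarrow> real" and k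
    by (simp add: sum_subtractf sum_distrib_left)
  have b: "B.S k \<omega> = Re (- \<i> * u * (Z (k * h) \<omega> - Z 0 \<omega>))" for k \<omega>
    unfolding B.S_def lin X Y by (simp add: c_def s_def)
  have a': "grid_event u h n I = A.alive I n" for I
    by (simp only: grid_event_def A.alive_def a)
  have b': "grid_event (- \<i> * u) h n J = B.alive J n" for J
    by (simp only: grid_event_def B.alive_def b)
  show ?thesis
    by (rule that[OF A.gauss_walk_axioms B.gauss_walk_axioms a' b'])
      (unfold a' b', rule P.rotated_alive_product[OF cs])
qed

lemma grid_event_sets [measurable]:
  assumes "cmod u = 1" "n > 0" "h > 0" "I \<in> sets borel"
  shows "grid_event u h n I \<in> sets M"
proof -
  obtain \<xi> where w: "gauss_walk M \<xi> n h" "\<And>I. grid_event u h n I = iid_walk.alive M \<xi> I n"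
    using grid_walk[OF assms(1-3)] by metis
  interpret gauss_walk M \<xi> n h by (rule w)
  show ?thesis unfolding w using assms by simp
qed

lemma grid_product:
  assumes "cmod u = 1" "n > 0" "h > 0" "I \<in> sets borel" "J \<in> sets borel"
  shows "prob (grid_event u h n I \<inter> grid_event (- \<i> * u) h n J) = prob (grid_event u h n I) * prob (grid_event (- \<i> * u) h n J)"
  using grid_walk[OF assms(1-3)] assms(4,5) by metis

lemma grid_bounds:
  assumes "cmod u = 1" "n > 0" "h > 0"
  shows "a > 0 \<Longrightarrow> measure (gauss (n * h)) {y. \<bar>y\<bar> < a} \<le> prob (grid_event u h n {- a..})"
    and "a > 0 \<Longrightarrow> prob (grid_event u h n {- a..}) \<le> measure (gauss (n * h)) {y. \<bar>y\<bar> \<le> a + 1} + n * (3 * h\<^sup>2)"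
    and "\<rho> > 0 \<Longrightarrow> exp (- ((pi / (2 * \<rho>))\<^sup>2 * (n * h) / 2)) - n * (3 * h\<^sup>2 / (2 * \<rho>) ^ 4)
      \<le> prob (grid_event u h n {- \<rho>..\<rho>})"
proof -
  obtain \<xi> where w: "gauss_walk M \<xi> n h" "\<And>I. grid_event u h n I = iid_walk.alive M \<xi> I n"
    using grid_walk[OF assms(1-3)] by metis
  interpret gauss_walk M \<xi> n h by (rule w)
  show "a > 0 \<Longrightarrow> measure (gauss (n * h)) {y. \<bar>y\<bar> < a} \<le> prob (grid_event u h n {- a..})"
    "a > 0 \<Longrightarrow> prob (grid_event u h n {- a..}) \<le> measure (gauss (n * h)) {y. \<bar>y\<bar> \<le> a + 1} + n * (3 * h\<^sup>2)"
    "\<rho> > 0 \<Longrightarrow> exp (- ((pi / (2 * \<rho>))\<^sup>2 * (n * h) / 2)) - n * (3 * h\<^sup>2 / (2 * \<rho>) ^ 4)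
      \<le> prob (grid_event u h n {- \<rho>..\<rho>})"
    unfolding w by (rule half_line_lower half_line_upper interval_lower; assumption)+
qed

text \<open>Dyadic times are dense in \<open>{0..t}\<close>, the path is continuous and
  \<open>I\<close> is closed, so the constraint at dyadic times passes to all times.\<close>

lemma path_event_eq:
  assumes "t > 0" "closed I"
  shows "path_event u t I = (\<Inter>m. grid_event u (t / 2 ^ m) (2 ^ m) I)"
proof (intro equalityI subsetI)
  fix \<omega> assume "\<omega> \<in> path_event u t I"
  moreover have "real k * (t / 2 ^ m) \<in> {0..t}" if "k \<le> 2 ^ m" for k m :: nat
    using that assms(1) of_nat_mono[OF that, where 'a=real] by (simp add: field_simps)
  ultimately show "\<omega> \<in> (\<Inter>m. grid_event u (t / 2 ^ m) (2 ^ m) I)"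
    by (auto simp: path_event_def grid_event_def simp del: times_divide_eq_right)
next
  fix \<omega> assume \<omega>: "\<omega> \<in> (\<Inter>m. grid_event u (t / 2 ^ m) (2 ^ m) I)"
  then have sp: "\<omega> \<in> space M" by (auto simp: grid_event_def)
  have "Re (u * (Z s \<omega> - Z 0 \<omega>)) \<in> I" if s: "s \<in> {0..t}" for s
  proof -
    obtain k :: "nat \<Rightarrow> nat" where k: "\<And>m. k m \<le> 2 ^ m" "(\<lambda>m. k m * (t / 2 ^ m)) \<longlonglongrightarrow> s"
      by (rule dyadic_approximation_from_above[of s t]) (use s assms(1) in auto)
    have "(\<lambda>m. Z (k m * (t / 2 ^ m)) \<omega>) \<longlonglongrightarrow> Z s \<omega>"
      by (rule continuous_on_tendsto_compose[OF Z_continuous[OF sp] k(2)]) (use s assms(1) in auto)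
    then have lim: "(\<lambda>m. Re (u * (Z (k m * (t / 2 ^ m)) \<omega> - Z 0 \<omega>))) \<longlonglongrightarrow> Re (u * (Z s \<omega> - Z 0 \<omega>))"
      by (intro tendsto_intros)
    have "Re (u * (Z (k m * (t / 2 ^ m)) \<omega> - Z 0 \<omega>)) \<in> I" for m
    proof -
      have "\<omega> \<in> grid_event u (t / 2 ^ m) (2 ^ m) I" using \<omega> by blast
      then show ?thesis using k(1)[of m] unfolding grid_event_def by blast
    qed
    from closed_sequentially[OF assms(2) this lim] show ?thesis .
  qed
  then show "\<omega> \<in> path_event u t I" using sp by (auto simp: path_event_def)
qed

text \<open>Dyadic refinement makes the grid events decrease to the path event, so their
  probabilities converge and an eventual lower bound survives the limit. On each grid the two
  coordinates contribute a product.\<close>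

lemma path_event_prob_lower:
  assumes t: "t > 0" and I: "closed I" and J: "closed J" and u: "cmod u = 1"
    and ev: "eventually (\<lambda>m. b \<le> prob (grid_event u (t / 2 ^ m) (2 ^ m) I) * prob (grid_event (- \<i> * u) (t / 2 ^ m) (2 ^ m) J)) sequentially"
  shows "b \<le> prob (path_event u t I \<inter> path_event (- \<i> * u) t J)"
proof -
  define E where "E m = grid_event u (t / 2 ^ m) (2 ^ m) I \<inter> grid_event (- \<i> * u) (t / 2 ^ m) (2 ^ m) J" for m
  have iu: "cmod (- \<i> * u) = 1" using u by (simp add: norm_mult)
  \<comment> \<open>The point of index \<open>k\<close> on the coarse grid is the point of index
    \<open>2 * k\<close> on the next one.\<close>
  have dec: "grid_event v (t / 2 ^ Suc m) (2 ^ Suc m) K \<subseteq> grid_event v (t / 2 ^ m) (2 ^ m) K" for v m K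
  proof
    fix \<omega> assume \<omega>: "\<omega> \<in> grid_event v (t / 2 ^ Suc m) (2 ^ Suc m) K"
    show "\<omega> \<in> grid_event v (t / 2 ^ m) (2 ^ m) K"
      unfolding grid_event_def
    proof (intro CollectI conjI allI impI)
      show "\<omega> \<in> space M" using \<omega> by (simp add: grid_event_def)
      fix k :: nat assume "k \<le> 2 ^ m"
      then have "2 * k \<le> 2 ^ Suc m" by simp
      then have "Re (v * (Z (real (2 * k) * (t / 2 ^ Suc m)) \<omega> - Z 0 \<omega>)) \<in> K"
        using \<omega> unfolding grid_event_def by blast
      moreover have "real (2 * k) * (t / 2 ^ Suc m) = k * (t / 2 ^ m)" by simp
      ultimately show "Re (v * (Z (k * (t / 2 ^ m)) \<omega> - Z 0 \<omega>)) \<in> K" by simp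
    qed
  qed
  have "decseq E"
    unfolding E_def by (rule decseq_SucI) (use dec in blast)
  moreover have "range E \<subseteq> sets M"
    unfolding E_def using t u iu I J by (auto intro!: sets.Int grid_event_sets)
  ultimately have "(\<lambda>m. prob (E m)) \<longlonglongrightarrow> prob (\<Inter>m. E m)"
    by (intro finite_Lim_measure_decseq)
  moreover have "(\<Inter>m. E m) = path_event u t I \<inter> path_event (- \<i> * u) t J"
    unfolding path_event_eq[OF t I] path_event_eq[OF t J] E_def by auto
  moreover have "prob (E m) = prob (grid_event u (t / 2 ^ m) (2 ^ m) I) * prob (grid_event (- \<i> * u) (t / 2 ^ m) (2 ^ m) J)" for m
    unfolding E_def using t u I J by (intro grid_product) auto
  ultimately show ?thesis
    using ev by (intro tendsto_lowerbound[of "\<lambda>m. prob (E m)" _ sequentially]) auto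
qed

text \<open>The closed endpoint \<open>t\<close> matches the strict inequality: since
  \<open>D\<close> is open and the path continuous, the path stays in \<open>D\<close> for a further
  time \<open>d\<close> after \<open>t\<close>, which keeps the infimum at or above
  \<open>t + d\<close>.\<close>

lemma exit_time_gt_iff:
  assumes "open D" "t > 0" "\<omega> \<in> space M"
  shows "exit_time Z D \<omega> > ennreal t \<longleftrightarrow> (\<forall>s\<in>{0<..t}. Z s \<omega> \<in> D)"
proof
  assume gt: "exit_time Z D \<omega> > ennreal t"
  show "\<forall>s\<in>{0<..t}. Z s \<omega> \<in> D"
  proof (rule ballI, rule ccontr)
    fix s assume s: "s \<in> {0<..t}" "Z s \<omega> \<notin> D"
    then have "exit_time Z D \<omega> \<le> ennreal s"
      unfolding exit_time_def by (intro INF_lower) auto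
    also have "\<dots> \<le> ennreal t" using s by (intro ennreal_leI) auto
    finally show False using gt by simp
  qed
next
  assume D: "\<forall>s\<in>{0<..t}. Z s \<omega> \<in> D"
  have "continuous (at t within {0..}) (\<lambda>t. Z t \<omega>)"
    using Z_continuous[OF assms(3)] assms(2) by (simp add: continuous_on_eq_continuous_within)
  moreover obtain e where e: "e > 0" "ball (Z t \<omega>) e \<subseteq> D"
    using assms(1,2) D openE[of D "Z t \<omega>"] by auto
  ultimately obtain d where d': "d > 0" "\<forall>s\<in>{0..}. dist s t < d \<longrightarrow> dist (Z s \<omega>) (Z t \<omega>) < e"
    unfolding continuous_within_eps_delta by blast
  have d: "d > 0" "\<And>s. s \<in> {0..} \<Longrightarrow> dist s t < d \<Longrightarrow> Z s \<omega> \<in> D"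
    using d' e by (auto simp: dist_commute)
  have "ennreal t < ennreal (t + d)" using d assms(2) by (simp add: ennreal_less_iff)
  also have "\<dots> \<le> exit_time Z D \<omega>"
    unfolding exit_time_def
  proof (rule INF_greatest)
    fix s assume "s \<in> {s. s > 0 \<and> Z s \<omega> \<notin> D}"
    then have "s > 0" "Z s \<omega> \<notin> D" by auto
    then have "s > t" using D by force
    then have "s \<ge> t + d" using d(2)[of s] \<open>s > 0\<close> \<open>Z s \<omega> \<notin> D\<close> by (force simp: dist_real_def)
    then show "ennreal (t + d) \<le> ennreal s" by (rule ennreal_leI)
  qed
  finally show "exit_time Z D \<omega> > ennreal t" .
qed

text \<open>Staying in \<open>D\<close> constrains uncountably many times. Compactness turns it into
  a uniform positive distance from the complement on each \<open>{t / Suc n..t}\<close>, and by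
  continuity this can be tested at dyadic times.\<close>

lemma exit_time_sets [measurable]:
  assumes D: "open D" and t: "t > 0"
  shows "{\<omega> \<in> space M. exit_time Z D \<omega> > ennreal t} \<in> sets M"
\<comment> \<open>The distance to the empty set is \<open>0\<close> by convention, so the test by
  \<open>infdist\<close> would fail at every point if the complement of \<open>D\<close> were
  empty.\<close>
proof (cases "D = UNIV")
  case True
  then have "{\<omega> \<in> space M. exit_time Z D \<omega> > ennreal t} = space M"
    using exit_time_gt_iff[OF assms] by auto
  then show ?thesis by simp
next
  case False
  define f where "f = (\<lambda>s \<omega>. infdist (Z s \<omega>) (- D))"
  have D_iff: "Z s \<omega> \<in> D \<longleftrightarrow> f s \<omega> > 0" for s \<omega>
    using in_closed_iff_infdist_zero[of "- D" "Z s \<omega>"] D False infdist_nonneg[of "Z s \<omega>" "- D"]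
    by (auto simp: f_def less_le)
  \<comment> \<open>\<open>Z\<close> is in \<open>D\<close> on \<open>{0<..t}\<close> iff it keeps a positive distance from \<open>- D\<close> on each \<open>{t / Suc n..t}\<close>.
    Time \<open>0\<close> must be avoided because \<open>Z 0 = 0\<close> holds only almost surely.\<close>
  define A where "A n j = (\<Inter>m. \<Inter>k\<in>{k. k \<le> 2 ^ m \<and> t / Suc n \<le> real k * (t / 2 ^ m)}.
      {\<omega> \<in> space M. 1 / Suc j \<le> f (real k * (t / 2 ^ m)) \<omega>})" for n j :: nat
  have A_iff: "\<omega> \<in> A n j \<longleftrightarrow> \<omega> \<in> space M \<and> (\<forall>s\<in>{t / Suc n..t}. 1 / Suc j \<le> f s \<omega>)" for n j \<omega>
  proof
    assume \<omega>: "\<omega> \<in> A n j"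
    \<comment> \<open>Shows that \<open>k = 1\<close> is an admissible index for
      \<open>m = 0\<close>, so that membership in \<open>A n j\<close> does yield
      \<open>\<omega> \<in> space M\<close>.\<close>
    have "t / Suc n \<le> real (2 ^ 0) * (t / 2 ^ 0)" using t by (simp add: field_simps)
    then have sp: "\<omega> \<in> space M" using \<omega> unfolding A_def by fastforce
    have "1 / Suc j \<le> f s \<omega>" if s: "s \<in> {t / Suc n..t}" for s
    proof -
      have s0: "0 \<le> s" using s t by (auto intro: order_trans[rotated])
      obtain k :: "nat \<Rightarrow> nat" where k: "\<And>m. k m \<le> 2 ^ m" "\<And>m. s \<le> k m * (t / 2 ^ m)"
        "(\<lambda>m. k m * (t / 2 ^ m)) \<longlonglongrightarrow> s"
        by (rule dyadic_approximation_from_above[of s t]) (use s s0 t in auto)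
      have "(\<lambda>m. Z (k m * (t / 2 ^ m)) \<omega>) \<longlonglongrightarrow> Z s \<omega>"
        by (rule continuous_on_tendsto_compose[OF Z_continuous[OF sp] k(3)]) (use s0 t in auto)
      then have "(\<lambda>m. f (k m * (t / 2 ^ m)) \<omega>) \<longlonglongrightarrow> f s \<omega>"
        unfolding f_def by (intro tendsto_intros)
      moreover have "1 / Suc j \<le> f (k m * (t / 2 ^ m)) \<omega>" for m
      proof -
        \<comment> \<open>Approximation from above is essential here: a grid time below
          \<open>t / Suc n\<close> would not be constrained by \<open>A n j\<close>.\<close>
        have "t / Suc n \<le> k m * (t / 2 ^ m)" using k(2)[of m] s by (meson atLeastAtMost_iff order_trans)
        then show ?thesis using \<omega> k(1)[of m] unfolding A_def by blast
      qed
      ultimately show ?thesis by (intro tendsto_lowerbound[of _ _ sequentially]) auto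
    qed
    then show "\<omega> \<in> space M \<and> (\<forall>s\<in>{t / Suc n..t}. 1 / Suc j \<le> f s \<omega>)" using sp by auto
  next
    assume "\<omega> \<in> space M \<and> (\<forall>s\<in>{t / Suc n..t}. 1 / Suc j \<le> f s \<omega>)"
    moreover have "real k * (t / 2 ^ m) \<le> t" if "k \<le> 2 ^ m" for k m :: nat
      using that t of_nat_mono[OF that, where 'a=real] by (simp add: field_simps)
    ultimately show "\<omega> \<in> A n j" unfolding A_def by (auto simp del: times_divide_eq_right)
  qed
  have "{\<omega> \<in> space M. exit_time Z D \<omega> > ennreal t} = (\<Inter>n. \<Union>j. A n j)"
  proof (intro equalityI subsetI)
    fix \<omega> assume "\<omega> \<in> {\<omega> \<in> space M. exit_time Z D \<omega> > ennreal t}"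
    then have sp: "\<omega> \<in> space M" and \<omega>: "\<And>s. s \<in> {0<..t} \<Longrightarrow> f s \<omega> > 0"
      using exit_time_gt_iff[OF assms] D_iff by auto
    have "\<exists>j. \<omega> \<in> A n j" for n
    proof -
      have ne: "{t / Suc n..t} \<noteq> {}" using t by (simp add: field_simps)
      have pos: "t / Suc n > 0" using t by simp
      have "continuous_on {t / Suc n..t} (\<lambda>s. f s \<omega>)"
        unfolding f_def using pos
        by (intro continuous_intros continuous_on_subset[OF Z_continuous[OF sp]]) auto
      then obtain x where x: "x \<in> {t / Suc n..t}" "\<And>y. y \<in> {t / Suc n..t} \<Longrightarrow> f x \<omega> \<le> f y \<omega>"
        using continuous_attains_inf[OF compact_Icc ne] by blast
      have "f x \<omega> > 0" using x pos by (intro \<omega>) auto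
      then obtain j where "inverse (real (Suc j)) < f x \<omega>" using reals_Archimedean by blast
      then have "\<omega> \<in> A n j"
        unfolding A_iff using sp x(2) by (auto simp: inverse_eq_divide intro: order_trans less_imp_le)
      then show ?thesis ..
    qed
    then show "\<omega> \<in> (\<Inter>n. \<Union>j. A n j)" by auto
  next
    fix \<omega> assume \<omega>: "\<omega> \<in> (\<Inter>n. \<Union>j. A n j)"
    then have sp: "\<omega> \<in> space M" using A_iff by auto
    have "Z s \<omega> \<in> D" if s: "s \<in> {0<..t}" for s
    proof -
      obtain n where "inverse (real (Suc n)) < s / t" using reals_Archimedean[of "s / t"] s t by auto
      then have n: "t / Suc n \<le> s" using t by (simp add: field_simps)
      obtain j where "\<omega> \<in> A n j" using \<omega> by auto
      then have "1 / Suc j \<le> f s \<omega>" using n s unfolding A_iff by auto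
      moreover have "1 / real (Suc j) > 0" by simp
      ultimately show ?thesis unfolding D_iff by linarith
    qed
    then show "\<omega> \<in> {\<omega> \<in> space M. exit_time Z D \<omega> > ennreal t}"
      using exit_time_gt_iff[OF assms sp] sp by auto
  qed
  also have "\<dots> \<in> sets M"
  proof -
    have B: "{\<omega> \<in> space M. 1 / Suc j \<le> f (real k * (t / 2 ^ m)) \<omega>} \<in> sets M" for j k m :: nat
    proof -
      have Zm: "Z (real k * (t / 2 ^ m)) \<in> borel_measurable M" using t by (intro Z_measurable) simp
      have "(\<lambda>z. infdist z (- D)) \<in> borel_measurable borel"
        by (intro borel_measurable_continuous_onI continuous_intros)
      then have [measurable]: "f (real k * (t / 2 ^ m)) \<in> borel_measurable M"
        unfolding f_def by (rule measurable_compose[OF Zm])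
      show ?thesis by measurable
    qed
    \<comment> \<open>Countable intersections need a nonempty index set; \<open>k = 2 ^ m\<close>,
      the grid point \<open>t\<close>, always qualifies.\<close>
    have ne: "{k. k \<le> 2 ^ m \<and> t / Suc n \<le> real k * (t / 2 ^ m)} \<noteq> {}" for n m :: nat
    proof -
      have "2 ^ m \<in> {k. k \<le> 2 ^ m \<and> t / Suc n \<le> real k * (t / 2 ^ m)}"
        using t by (simp add: field_simps)
      then show ?thesis by blast
    qed
    have "A n j \<in> sets M" for n j
      unfolding A_def
      by (rule sets.countable_INT, rule image_subsetI, rule sets.countable_INT,
          rule image_subsetI, rule B, rule ne, simp)
    then show ?thesis by blast
  qed
  finally show ?thesis .
qed

end

subsection \<open>Tails and moments of exit times\<close>

context standard_planar_brownian_motion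
begin

text \<open>The half-line lower bound carries no overshoot error, so the bound is the same for every
  \<open>m\<close> and can be passed to the limit of the grids.\<close>

lemma half_line_grid_lower:
  assumes a: "a > 0" and t: "t \<ge> 1" and u: "cmod u = 1"
  shows "2 * a * exp (- (a\<^sup>2 / 2)) / sqrt (2 * pi) / sqrt t \<le> prob (grid_event u (t / 2 ^ m) (2 ^ m) {- a..})"
proof -
  have "measure (gauss ((2 ^ m :: nat) * (t / 2 ^ m))) {y. \<bar>y\<bar> < a} \<le> prob (grid_event u (t / 2 ^ m) (2 ^ m) {- a..})"
    using a t u by (intro grid_bounds) auto
  then show ?thesis using gauss_interval_lower[OF t a] by simp
qed

lemma half_line_grid_upper:
  assumes a: "a > 0" and t: "t \<ge> 1"
  obtains n where "n > 0" "\<And>u. cmod u = 1 \<Longrightarrow>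
    prob (grid_event u (t / real n) n {- a..}) \<le> (2 * (a + 1) / sqrt (2 * pi) + 1) / sqrt t"
proof -
  \<comment> \<open>With variance \<open>t / n\<close> per step the overshoot error is
    \<open>3 * t\<^sup>2 / n\<close>; this choice brings it below \<open>1 / sqrt t\<close>, the
    order of the main term. It does not depend on \<open>u\<close>, so one grid can serve both
    coordinates.\<close>
  obtain n :: nat where n: "3 * t\<^sup>2 * sqrt t \<le> n" "n > 0"
    using real_arch_simple[of "max 1 (3 * t\<^sup>2 * sqrt t)"] by auto
  have err: "real n * (3 * (t / n)\<^sup>2) \<le> 1 / sqrt t"
    using n t by (simp add: field_simps power2_eq_square)
  have "prob (grid_event u (t / real n) n {- a..}) \<le> (2 * (a + 1) / sqrt (2 * pi) + 1) / sqrt t"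
    if "cmod u = 1" for u
  proof -
    have "prob (grid_event u (t / real n) n {- a..})
        \<le> measure (gauss (real n * (t / n))) {y. \<bar>y\<bar> \<le> a + 1} + real n * (3 * (t / n)\<^sup>2)"
      using a t n that by (intro grid_bounds) auto
    also have "real n * (t / n) = t" using n by simp
    also have "measure (gauss t) {y. \<bar>y\<bar> \<le> a + 1} \<le> 2 * (a + 1) / sqrt (2 * pi) / sqrt t"
      using a t by (intro gauss_interval_upper) auto
    finally show ?thesis using err by (simp add: add_divide_distrib)
  qed
  with n that show ?thesis by blast
qed

lemma exit_time_lower:
  assumes D: "open D" and t: "t > 0"
    and sub: "\<And>z. Re (u * z) \<in> I \<Longrightarrow> Re (- \<i> * u * z) \<in> J \<Longrightarrow> z \<in> D"
  shows "prob (path_event u t I \<inter> path_event (- \<i> * u) t J) \<le> prob {\<omega> \<in> space M. exit_time Z D \<omega> > ennreal t}"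
proof (rule finite_measure_mono_AE)
  show "AE \<omega> in M. \<omega> \<in> path_event u t I \<inter> path_event (- \<i> * u) t J \<longrightarrow>
      \<omega> \<in> {\<omega> \<in> space M. exit_time Z D \<omega> > ennreal t}"
    using Z_start
  proof eventually_elim
    case (elim \<omega>)
    then show ?case
      using exit_time_gt_iff[OF D t, of \<omega>] sub by (auto simp: path_event_def simp del: mult_minus_left)
  qed
  show "{\<omega> \<in> space M. exit_time Z D \<omega> > ennreal t} \<in> events"
    using D t by (rule exit_time_sets)
qed

text \<open>A path in \<open>D\<close> up to time \<open>t\<close> satisfies the constraints at each
  positive grid time. The grid time \<open>0\<close> is not controlled by \<open>exit_time\<close>;
  there the increment is \<open>0\<close>, which is why \<open>0\<close> must lie in
  \<open>I\<close> and \<open>J\<close>.\<close>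

lemma exit_time_upper:
  assumes D: "open D" and t: "t > 0" and n: "n > 0" and IJ: "I \<in> sets borel" "J \<in> sets borel" "0 \<in> I" "0 \<in> J"
    and u: "cmod u = 1"
    and sub: "\<And>z. z \<in> D \<Longrightarrow> Re (u * z) \<in> I" "\<And>z. z \<in> D \<Longrightarrow> Re (- \<i> * u * z) \<in> J"
  shows "prob {\<omega> \<in> space M. exit_time Z D \<omega> > ennreal t}
    \<le> prob (grid_event u (t / real n) n I) * prob (grid_event (- \<i> * u) (t / real n) n J)"
proof -
  have iu: "cmod (- \<i> * u) = 1" using u by (simp add: norm_mult)
  have h: "t / real n > 0" using t n by simp
  have "prob {\<omega> \<in> space M. exit_time Z D \<omega> > ennreal t}
      \<le> prob (grid_event u (t / real n) n I \<inter> grid_event (- \<i> * u) (t / real n) n J)"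
  proof (rule finite_measure_mono_AE)
    show "grid_event u (t / real n) n I \<inter> grid_event (- \<i> * u) (t / real n) n J \<in> events"
      using u iu n h IJ by (intro sets.Int grid_event_sets)
    show "AE \<omega> in M. \<omega> \<in> {\<omega> \<in> space M. exit_time Z D \<omega> > ennreal t} \<longrightarrow>
        \<omega> \<in> grid_event u (t / real n) n I \<inter> grid_event (- \<i> * u) (t / real n) n J"
      using Z_start
    proof eventually_elim
      case (elim \<omega>)
      show ?case
      proof
        assume "\<omega> \<in> {\<omega> \<in> space M. exit_time Z D \<omega> > ennreal t}"
        then have sp: "\<omega> \<in> space M" and inD: "\<And>s. s \<in> {0<..t} \<Longrightarrow> Z s \<omega> \<in> D"
          using exit_time_gt_iff[OF D t] by auto
        have "Re (v * (Z (real k * (t / real n)) \<omega> - Z 0 \<omega>)) \<in> K"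
          if "k \<le> n" "\<And>z. z \<in> D \<Longrightarrow> Re (v * z) \<in> K" "0 \<in> K" for k v K
        proof (cases "k = 0")
          case True
          then show ?thesis using that by simp
        next
          case False
          then have "real k * (t / real n) \<in> {0<..t}" using that(1) t n by (simp add: field_simps)
          then have "Z (real k * (t / real n)) \<omega> \<in> D" by (rule inD)
          from that(2)[OF this] show ?thesis using elim by simp
        qed
        from this[OF _ sub(1)] this[OF _ sub(2)]
        show "\<omega> \<in> grid_event u (t / real n) n I \<inter> grid_event (- \<i> * u) (t / real n) n J"
          unfolding grid_event_def using sp IJ by blast
      qed
    qed
  qed
  also have "\<dots> = prob (grid_event u (t / real n) n I) * prob (grid_event (- \<i> * u) (t / real n) n J)"
    using u n h IJ by (intro grid_product)
  finally show ?thesis .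
qed

lemma exit_time_positive:
  assumes D: "open D" "0 \<in> D" and t: "t > 0"
  shows "prob {\<omega> \<in> space M. exit_time Z D \<omega> > ennreal t} > 0"
proof -
  obtain r where r: "r > 0" "ball 0 r \<subseteq> D" using D openE by blast
  \<comment> \<open>The closed square of half-side \<open>\<rho>\<close> lies in the disc of radius
    \<open>2 * \<rho>\<close>, which is strictly smaller than \<open>r\<close>.\<close>
  define \<rho> where "\<rho> = r / 4"
  have \<rho>: "\<rho> > 0" using r by (simp add: \<rho>_def)
  define e where "e = exp (- ((pi / (2 * \<rho>))\<^sup>2 * t / 2))"
  have e: "e > 0" by (simp add: e_def)
  let ?p = "\<lambda>v m. prob (grid_event v (t / 2 ^ m) (2 ^ m) {- \<rho>..\<rho>})"
  have ev: "eventually (\<lambda>m. e / 2 \<le> ?p v m) sequentially" if v: "cmod v = 1" for v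
  proof -
    \<comment> \<open>With \<open>2 ^ m\<close> steps of variance \<open>t / 2 ^ m\<close> the error
      of the interval bound is a constant times \<open>(1 / 2) ^ m\<close>, so at least half of the
      main term \<open>e\<close> remains eventually.\<close>
    have "(\<lambda>m. e - (3 * t\<^sup>2 / (2 * \<rho>) ^ 4) * (1 / 2) ^ m) \<longlonglongrightarrow> e - (3 * t\<^sup>2 / (2 * \<rho>) ^ 4) * 0"
      by (intro tendsto_intros) simp
    then have "eventually (\<lambda>m. e - (3 * t\<^sup>2 / (2 * \<rho>) ^ 4) * (1 / 2) ^ m > e / 2) sequentially"
      using e by (intro order_tendstoD) auto
    then show ?thesis
    proof eventually_elim
      case (elim m)
      have b: "exp (- ((pi / (2 * \<rho>))\<^sup>2 * ((2 ^ m :: nat) * (t / 2 ^ m)) / 2))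
          - (2 ^ m :: nat) * (3 * (t / 2 ^ m)\<^sup>2 / (2 * \<rho>) ^ 4) \<le> ?p v m"
        using v t \<rho> by (intro grid_bounds) auto
      have e1: "(2 ^ m :: nat) * (t / 2 ^ m) = t" by simp
      have e2: "(2 ^ m :: nat) * (3 * (t / 2 ^ m)\<^sup>2 / (2 * \<rho>) ^ 4) = (3 * t\<^sup>2 / (2 * \<rho>) ^ 4) * (1 / 2) ^ m"
        by (simp add: power_divide power2_eq_square)
      show ?case using b elim unfolding e1 e2 e_def[symmetric] by linarith
    qed
  qed
  have "0 < e / 2 * (e / 2)" using e by simp
  also have "e / 2 * (e / 2) \<le> prob (path_event 1 t {- \<rho>..\<rho>} \<inter> path_event (- \<i> * 1) t {- \<rho>..\<rho>})"
  proof (rule path_event_prob_lower[OF t])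
    show "eventually (\<lambda>m. e / 2 * (e / 2) \<le> ?p 1 m * ?p (- \<i> * 1) m) sequentially"
      using ev[of 1, simplified] ev[of "- \<i> * 1", simplified]
    proof eventually_elim
      case (elim m)
      then have "e / 2 * (e / 2) \<le> ?p 1 m * ?p (- \<i>) m"
        using e by (intro mult_mono) auto
      then show ?case by simp
    qed
  qed auto
  also have "\<dots> \<le> prob {\<omega> \<in> space M. exit_time Z D \<omega> > ennreal t}"
  proof (rule exit_time_lower[OF D(1) t])
    fix z assume "Re (1 * z) \<in> {- \<rho>..\<rho>}" "Re (- \<i> * 1 * z) \<in> {- \<rho>..\<rho>}"
    then have "cmod z \<le> 2 * \<rho>" using cmod_le[of z] by auto
    then have "z \<in> ball 0 r" using r by (simp add: \<rho>_def)
    then show "z \<in> D" using r by auto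
  qed
  finally show ?thesis .
qed

lemma half_plane_tail:
  assumes a: "a > 0" and u: "cmod u = 1" and W: "W = {z. Re (u * z) > - a}"
  obtains c C where "c > 0"
    "\<And>t. t \<ge> 1 \<Longrightarrow> c * t powr - (1 / 2) \<le> prob {\<omega> \<in> space M. exit_time Z W \<omega> > ennreal t}"
    "\<And>t. t \<ge> 1 \<Longrightarrow> prob {\<omega> \<in> space M. exit_time Z W \<omega> > ennreal t} \<le> C * t powr - (1 / 2)"
proof
  define c where "c = (\<lambda>a. 2 * a * exp (- (a\<^sup>2 / 2)) / sqrt (2 * pi))"
  have op: "open W" unfolding W by (intro open_Collect_less continuous_intros)
  show "c (a / 2) > 0" using a by (simp add: c_def)
  fix t :: real assume t: "t \<ge> 1"
  have pw: "t powr - (1 / 2) = 1 / sqrt t" using t by (simp add: powr_minus powr_half_sqrt inverse_eq_divide)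
  have full: "grid_event v h n UNIV = space M" for v h n by (simp add: grid_event_def)
  \<comment> \<open>Path events need closed sets while \<open>W\<close> is open: the closed
    half-line at \<open>- (a / 2)\<close> lies strictly inside the condition \<open>> - a\<close>.
    The other coordinate is left free by \<open>UNIV\<close>.\<close>
  have "c (a / 2) / sqrt t \<le> prob (path_event u t {- (a / 2)..} \<inter> path_event (- \<i> * u) t UNIV)"
  proof (rule path_event_prob_lower)
    show "eventually (\<lambda>m. c (a / 2) / sqrt t \<le> prob (grid_event u (t / 2 ^ m) (2 ^ m) {- (a / 2)..})
        * prob (grid_event (- \<i> * u) (t / 2 ^ m) (2 ^ m) UNIV)) sequentially"
      using half_line_grid_lower[of "a / 2" t u] a t u by (simp add: full prob_space c_def)
  qed (use t u in auto)
  also have "\<dots> \<le> prob {\<omega> \<in> space M. exit_time Z W \<omega> > ennreal t}"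
    by (rule exit_time_lower) (use op t u a W in auto)
  finally show "c (a / 2) * t powr - (1 / 2) \<le> prob {\<omega> \<in> space M. exit_time Z W \<omega> > ennreal t}"
    by (simp add: pw)
  obtain n where n: "n > 0" "\<And>u. cmod u = 1 \<Longrightarrow>
      prob (grid_event u (t / real n) n {- a..}) \<le> (2 * (a + 1) / sqrt (2 * pi) + 1) / sqrt t"
    by (rule half_line_grid_upper[OF a t]) (use that in blast)
  have "prob {\<omega> \<in> space M. exit_time Z W \<omega> > ennreal t}
      \<le> prob (grid_event u (t / real n) n {- a..}) * prob (grid_event (- \<i> * u) (t / real n) n UNIV)"
    by (rule exit_time_upper) (use op t n u a W in auto)
  also have "\<dots> \<le> (2 * (a + 1) / sqrt (2 * pi) + 1) / sqrt t"
    using n(2)[OF u] by (simp add: full prob_space)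
  finally show "prob {\<omega> \<in> space M. exit_time Z W \<omega> > ennreal t} \<le> (2 * (a + 1) / sqrt (2 * pi) + 1) * t powr - (1 / 2)"
    by (simp add: pw)
qed

lemma quarter_plane_tail:
  assumes a: "a > 0" and b: "b > 0" and u: "cmod u = 1" and W: "W = {z. Re (u * z) > - a \<and> Re (- \<i> * u * z) > - b}"
  obtains c C where "c > 0"
    "\<And>t. t \<ge> 1 \<Longrightarrow> c * t powr - 1 \<le> prob {\<omega> \<in> space M. exit_time Z W \<omega> > ennreal t}"
    "\<And>t. t \<ge> 1 \<Longrightarrow> prob {\<omega> \<in> space M. exit_time Z W \<omega> > ennreal t} \<le> C * t powr - 1"
proof
  define c where "c = (\<lambda>a. 2 * a * exp (- (a\<^sup>2 / 2)) / sqrt (2 * pi))"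
  \<comment> \<open>For the upper bound both barriers are lowered to \<open>- k\<close>, so that a
    single application of \<open>half_line_grid_upper\<close>, hence a single grid, handles both
    coordinates. Only the constant gets worse.\<close>
  define k where "k = max a b"
  have k: "k > 0" "a \<le> k" "b \<le> k" using a by (auto simp: k_def)
  have op: "open W" unfolding W by (intro open_Collect_conj open_Collect_less continuous_intros)
  have c0: "c (a / 2) > 0" "c (b / 2) > 0" using a b by (auto simp: c_def)
  then show "c (a / 2) * c (b / 2) > 0" by simp
  fix t :: real assume t: "t \<ge> 1"
  have pw: "t powr - 1 = 1 / sqrt t * (1 / sqrt t)" using t by (simp add: powr_minus inverse_eq_divide)
  have iu: "cmod (- \<i> * u) = 1" using u by (simp add: norm_mult)
  have "c (a / 2) / sqrt t * (c (b / 2) / sqrt t) \<le> prob (path_event u t {- (a / 2)..} \<inter> path_event (- \<i> * u) t {- (b / 2)..})"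
  proof (rule path_event_prob_lower)
    have "c (a / 2) / sqrt t * (c (b / 2) / sqrt t) \<le> prob (grid_event u (t / 2 ^ m) (2 ^ m) {- (a / 2)..})
        * prob (grid_event (- \<i> * u) (t / 2 ^ m) (2 ^ m) {- (b / 2)..})" for m
    proof (rule mult_mono)
      show "c (a / 2) / sqrt t \<le> prob (grid_event u (t / 2 ^ m) (2 ^ m) {- (a / 2)..})"
        using half_line_grid_lower[of "a / 2" t u] a t u by (simp add: c_def)
      show "c (b / 2) / sqrt t \<le> prob (grid_event (- \<i> * u) (t / 2 ^ m) (2 ^ m) {- (b / 2)..})"
        unfolding c_def using half_line_grid_lower[OF _ t iu, of "b / 2"] b by simp
    qed (use c0 t in auto)
    then show "eventually (\<lambda>m. c (a / 2) / sqrt t * (c (b / 2) / sqrt t) \<le> prob (grid_event u (t / 2 ^ m) (2 ^ m) {- (a / 2)..})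
        * prob (grid_event (- \<i> * u) (t / 2 ^ m) (2 ^ m) {- (b / 2)..})) sequentially"
      by (rule always_eventually[OF allI])
  qed (use t u in auto)
  also have "\<dots> \<le> prob {\<omega> \<in> space M. exit_time Z W \<omega> > ennreal t}"
    by (rule exit_time_lower) (use op t u a b W in auto)
  finally show "c (a / 2) * c (b / 2) * t powr - 1 \<le> prob {\<omega> \<in> space M. exit_time Z W \<omega> > ennreal t}"
    by (simp add: pw)
  obtain n where n: "n > 0" "\<And>u. cmod u = 1 \<Longrightarrow>
      prob (grid_event u (t / real n) n {- k..}) \<le> (2 * (k + 1) / sqrt (2 * pi) + 1) / sqrt t"
    by (rule half_line_grid_upper[OF k(1) t]) (use that in blast)
  have "prob {\<omega> \<in> space M. exit_time Z W \<omega> > ennreal t}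
      \<le> prob (grid_event u (t / real n) n {- k..}) * prob (grid_event (- \<i> * u) (t / real n) n {- k..})"
    by (rule exit_time_upper) (use op t n u k W in auto)
  also have "\<dots> \<le> (2 * (k + 1) / sqrt (2 * pi) + 1) / sqrt t * ((2 * (k + 1) / sqrt (2 * pi) + 1) / sqrt t)"
    using n(2)[OF u] n(2)[OF iu] k t by (intro mult_mono) auto
  finally show "prob {\<omega> \<in> space M. exit_time Z W \<omega> > ennreal t} \<le> (2 * (k + 1) / sqrt (2 * pi) + 1)\<^sup>2 * t powr - 1"
    by (simp add: pw power2_eq_square)
qed

text \<open>A dyadic layer estimate. Where the exit time lies in \<open>(2 ^ j, 2 ^ Suc j]\<close>
  its power is at most \<open>w j\<close>, and by the tail bound \<open>w j * prob (E j)\<close> is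
  at most \<open>C * 2 powr p * q ^ j\<close> with \<open>q = 2 powr (p - h) < 1\<close>, so the
  series is geometric. Exit times up to \<open>1\<close> contribute at most
  \<open>1\<close>.\<close>

lemma moment_finite:
  assumes D: "open D" and tail: "\<And>t. t \<ge> 1 \<Longrightarrow> prob {\<omega> \<in> space M. exit_time Z D \<omega> > ennreal t} \<le> C * t powr - h"
    and p: "0 < p" "p < h"
  shows "(\<integral>\<^sup>+\<omega>. ennreal_powr (exit_time Z D \<omega>) p \<partial>M) < \<infinity>"
proof -
  define E where "E k = {\<omega> \<in> space M. exit_time Z D \<omega> > ennreal (2 ^ k)}" for k :: nat
  have E [measurable]: "E k \<in> sets M" for k unfolding E_def by (rule exit_time_sets[OF D]) simp
  define w where "w k = (2 ^ Suc k) powr p" for k :: nat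
  have w1: "w k \<ge> 1" for k unfolding w_def using p by (intro ge_one_powr_ge_zero one_le_power) auto
  have bound: "ennreal_powr (exit_time Z D \<omega>) p \<le> 1 + (\<Sum>k. ennreal (w k) * indicator (E k) \<omega>)"
    if \<omega>: "\<omega> \<in> space M" for \<omega>
  proof (cases "exit_time Z D \<omega>")
    case (real r)
    show ?thesis
    proof (cases "r \<le> 1")
      case True
      then have "r powr p \<le> 1" using real p by (simp add: powr_le1)
      then have "ennreal_powr (exit_time Z D \<omega>) p \<le> 1" using real by (simp add: ennreal_powr_def)
      then show ?thesis by (rule order_trans) simp
    next
      case False
      have ex: "\<exists>k. r \<le> 2 ^ k" using real_arch_pow[of 2 r] by (auto intro: less_imp_le)
      define k where "k = (LEAST k. r \<le> 2 ^ k)"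
      have k: "r \<le> 2 ^ k" unfolding k_def using ex by (rule LeastI_ex)
      then obtain j where j: "k = Suc j" using False by (cases k) auto
      then have "\<not> r \<le> 2 ^ j" using not_less_Least[of j "\<lambda>k. r \<le> 2 ^ k"] by (simp add: k_def[symmetric])
      then have "\<omega> \<in> E j" using \<omega> real by (simp add: E_def ennreal_less_iff)
      have "r powr p \<le> w j" unfolding w_def using k j False p by (intro powr_mono2) auto
      then have "ennreal_powr (exit_time Z D \<omega>) p \<le> ennreal (w j) * indicator (E j) \<omega>"
        using real \<open>\<omega> \<in> E j\<close> by (simp add: ennreal_powr_def ennreal_leI)
      also have "\<dots> = (\<Sum>k\<in>{j}. ennreal (w k) * indicator (E k) \<omega>)"
        by (subst sum.insert) simp_all
      also have "\<dots> \<le> (\<Sum>k. ennreal (w k) * indicator (E k) \<omega>)"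
        by (rule sum_le_suminf) auto
      finally show ?thesis by (rule order_trans) simp
    qed
  next
    \<comment> \<open>An infinite exit time lies in every \<open>E k\<close>, and the weights are at
      least \<open>1\<close>, so the series on the right is infinite as well.\<close>
    case top
    have "of_nat N \<le> (\<Sum>k. ennreal (w k) * indicator (E k) \<omega>)" for N
    proof -
      have "of_nat N = (\<Sum>k<N. 1 :: ennreal)" by simp
      also have "\<dots> \<le> (\<Sum>k<N. ennreal (w k) * indicator (E k) \<omega>)"
        using \<omega> top w1 by (intro sum_mono) (auto simp: E_def)
      also have "\<dots> \<le> (\<Sum>k. ennreal (w k) * indicator (E k) \<omega>)"
        by (rule sum_le_suminf) auto
      finally show ?thesis .
    qed
    then have "(\<Sum>k. ennreal (w k) * indicator (E k) \<omega>) = top"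
      by (metis ennreal_Ex_less_of_nat less_top not_less)
    then show ?thesis by simp
  qed
  define q where "q = 2 powr (p - h)"
  have q: "0 < q" "q < 1" using p by (auto simp: q_def powr_less_one)
  have C: "C \<ge> 0" using tail[of 1] measure_nonneg[of M] by (simp add: order_trans[OF measure_nonneg])
  have summand: "ennreal (w k) * emeasure M (E k) \<le> ennreal (C * 2 powr p * q ^ k)" for k
  proof -
    have "w k * prob (E k) \<le> w k * (C * (2 ^ k) powr - h)"
      using tail[of "2 ^ k"] w1[of k] by (intro mult_left_mono) (auto simp: E_def)
    also have "w k * (C * (2 ^ k) powr - h) = C * 2 powr p * q ^ k"
    proof -
      have "(2 ^ Suc k) powr p = (2 powr real (Suc k)) powr p"
        by (simp only: powr_realpow zero_less_numeral)
      also have "\<dots> = 2 powr p * 2 powr (real k * p)"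
        by (simp only: powr_powr powr_add[symmetric]) (simp add: algebra_simps)
      finally have "(2 ^ Suc k) powr p = 2 powr p * 2 powr (real k * p)" .
      moreover have "(2 ^ k) powr - h = 2 powr (- real k * h)"
        by (simp add: powr_realpow[symmetric] powr_powr)
      moreover have "q ^ k = 2 powr (real k * p) * 2 powr (- real k * h)"
        by (simp add: q_def powr_realpow[symmetric] powr_powr powr_add[symmetric] algebra_simps)
      ultimately show ?thesis by (simp add: w_def)
    qed
    finally show ?thesis
      using w1[of k] by (simp add: emeasure_eq_measure ennreal_mult[symmetric] ennreal_leI)
  qed
  have "(\<integral>\<^sup>+\<omega>. ennreal_powr (exit_time Z D \<omega>) p \<partial>M) \<le> (\<integral>\<^sup>+\<omega>. 1 + (\<Sum>k. ennreal (w k) * indicator (E k) \<omega>) \<partial>M)"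
    by (rule nn_integral_mono) (rule bound)
  also have "\<dots> = 1 + (\<Sum>k. ennreal (w k) * emeasure M (E k))"
    by (subst nn_integral_add) (auto simp: nn_integral_suminf nn_integral_cmult emeasure_space_1)
  also have "\<dots> \<le> 1 + (\<Sum>k. ennreal (C * 2 powr p * q ^ k))"
    by (intro add_left_mono suminf_le summand) auto
  also have "\<dots> < \<infinity>"
  proof -
    have "summable (\<lambda>k. C * 2 powr p * q ^ k)" using q by (intro summable_mult summable_geometric) auto
    then have "(\<Sum>k. ennreal (C * 2 powr p * q ^ k)) = ennreal (\<Sum>k. C * 2 powr p * q ^ k)"
      using C q by (intro suminf_ennreal2) auto
    then show ?thesis by simp
  qed
  finally show ?thesis .
qed

text \<open>The integrand dominates \<open>t powr p\<close> on the event, so the comparison is made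
  directly with the indicator of this measurable set.\<close>

lemma exit_time_Markov:
  assumes D: "open D" and p: "p > 0" and fin: "(\<integral>\<^sup>+\<omega>. ennreal_powr (exit_time Z D \<omega>) p \<partial>M) < \<infinity>"
  obtains K where "K > 0" "\<And>t. t > 0 \<Longrightarrow> prob {\<omega> \<in> space M. exit_time Z D \<omega> > ennreal t} \<le> K * t powr - p"
proof
  define e where "e = enn2real (\<integral>\<^sup>+\<omega>. ennreal_powr (exit_time Z D \<omega>) p \<partial>M)"
  have e: "(\<integral>\<^sup>+\<omega>. ennreal_powr (exit_time Z D \<omega>) p \<partial>M) = ennreal e" "e \<ge> 0"
    using fin by (auto simp: e_def)
  \<comment> \<open>Adding \<open>1\<close> keeps the constant strictly positive, as it will be
    divided by.\<close>
  then show "e + 1 > 0" by simp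
  fix t :: real assume t: "t > 0"
  let ?E = "{\<omega> \<in> space M. exit_time Z D \<omega> > ennreal t}"
  have E [measurable]: "?E \<in> sets M" by (rule exit_time_sets[OF D t])
  have "ennreal (t powr p * prob ?E) = (\<integral>\<^sup>+\<omega>. ennreal (t powr p) * indicator ?E \<omega> \<partial>M)"
    using E by (simp add: nn_integral_cmult emeasure_eq_measure ennreal_mult)
  also have "\<dots> \<le> ennreal e"
    unfolding e(1)[symmetric]
  proof (rule nn_integral_mono)
    fix \<omega> assume "\<omega> \<in> space M"
    show "ennreal (t powr p) * indicator ?E \<omega> \<le> ennreal_powr (exit_time Z D \<omega>) p"
    proof (cases "\<omega> \<in> ?E")
      case True
      show ?thesis
      proof (cases "exit_time Z D \<omega>")
        case (real r)
        then have "t \<le> r" using True t by (simp add: ennreal_less_iff)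
        then have "t powr p \<le> r powr p" using t p by (intro powr_mono2) auto
        then show ?thesis using True real by (simp add: ennreal_powr_def ennreal_leI)
      qed (use True in \<open>simp add: ennreal_powr_def\<close>)
    qed simp
  qed
  finally have "t powr p * prob ?E \<le> e" using e by simp
  then have "prob ?E \<le> e * t powr - p" using t by (simp add: powr_minus field_simps)
  also have "\<dots> \<le> (e + 1) * t powr - p" by (simp add: distrib_right)
  finally show "prob ?E \<le> (e + 1) * t powr - p" .
qed

lemma tail_ratio:
  assumes U: "open U" "0 \<in> U" and W: "open W"
    and c: "c > 0" and lower: "\<And>t. t \<ge> 1 \<Longrightarrow> c * t powr - h \<le> prob {\<omega> \<in> space M. exit_time Z W \<omega> > ennreal t}"
    and upper: "\<And>t. t \<ge> 1 \<Longrightarrow> prob {\<omega> \<in> space M. exit_time Z W \<omega> > ennreal t} \<le> C * t powr - h"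
    and H: "exit_moment_exponent M Z U > exit_moment_exponent M Z W"
  shows "filterlim
      (\<lambda>t::real. prob {\<omega> \<in> space M. exit_time Z W \<omega> > ennreal t} / prob {\<omega> \<in> space M. exit_time Z U \<omega> > ennreal t})
      at_top at_top"
proof -
  obtain p where p: "p > 0" "(\<integral>\<^sup>+\<omega>. ennreal_powr (exit_time Z U \<omega>) p \<partial>M) < \<infinity>"
      "exit_moment_exponent M Z W < ennreal p"
    using H unfolding exit_moment_exponent_def[of M Z U] less_SUP_iff by auto
  \<comment> \<open>Otherwise some \<open>q\<close> lies strictly between the exponent of
    \<open>W\<close> and \<open>p\<close>, hence below \<open>h\<close>. The upper tail bound makes
    the moment of order \<open>q\<close> finite, so the exponent of \<open>W\<close> is at least
    \<open>q\<close>, a contradiction.\<close>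
  have "p > h"
  proof (rule ccontr)
    assume "\<not> p > h"
    obtain r where r: "exit_moment_exponent M Z W = ennreal r" "r \<ge> 0"
      using p(3) by (cases "exit_moment_exponent M Z W") auto
    then have "r < p" using p(3) by (simp add: ennreal_less_iff)
    define q where "q = (r + p) / 2"
    have q: "0 < q" "r < q" "q < h" using \<open>r < p\<close> r \<open>\<not> p > h\<close> by (auto simp: q_def)
    have "ennreal q \<le> exit_moment_exponent M Z W"
      unfolding exit_moment_exponent_def
      using moment_finite[OF W upper q(1,3)] q by (intro SUP_upper) auto
    then show False using q r by simp
  qed
  obtain K where K: "K > 0" "\<And>t. t > 0 \<Longrightarrow> prob {\<omega> \<in> space M. exit_time Z U \<omega> > ennreal t} \<le> K * t powr - p"
    by (rule exit_time_Markov[OF U(1) p(1,2)]) (use that in blast)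
  have "filterlim (\<lambda>t::real. c / K * t powr (p - h)) at_top at_top"
  proof (rule filterlim_tendsto_pos_mult_at_top[OF tendsto_const])
    have "filterlim (\<lambda>t. (p - h) * ln t) at_top at_top"
      using \<open>p > h\<close> by (intro filterlim_tendsto_pos_mult_at_top[OF tendsto_const] ln_at_top) simp
    then have "filterlim (\<lambda>t. exp ((p - h) * ln t)) at_top at_top"
      by (rule filterlim_compose[OF exp_at_top])
    then show "filterlim (\<lambda>t. t powr (p - h)) at_top at_top"
      by (rule filterlim_mono_eventually[OF _ order_refl order_refl])
        (auto simp: powr_def intro: eventually_mono[OF eventually_gt_at_top[of 0]])
  qed (use c K in simp)
  moreover have "eventually (\<lambda>t::real. c / K * t powr (p - h) \<le>
      prob {\<omega> \<in> space M. exit_time Z W \<omega> > ennreal t} / prob {\<omega> \<in> space M. exit_time Z U \<omega> > ennreal t}) at_top"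
    using eventually_ge_at_top[of 1]
  proof eventually_elim
    case (elim t)
    have "c / K * t powr (p - h) = (c * t powr - h) / (K * t powr - p)"
      using elim by (simp add: powr_diff powr_minus field_simps)
    also have "\<dots> \<le> prob {\<omega> \<in> space M. exit_time Z W \<omega> > ennreal t} / prob {\<omega> \<in> space M. exit_time Z U \<omega> > ennreal t}"
      using elim c K lower[of t] exit_time_positive[OF U, of t] by (intro frac_le) auto
    finally show ?case .
  qed
  ultimately show ?thesis by (rule filterlim_at_top_mono)
qed

end

section \<open>Reduction of half-planes and quarter-planes to inequalities in rotated
  coordinates\<close>

lemma rotate_translate_image:
  "rotate_translate \<theta> a ` {z. P z} = {z. P (cis (- \<theta>) * z - cis (- \<theta>) * a)}"
proof (intro equalityI subsetI)
  fix z assume "z \<in> {z. P (cis (- \<theta>) * z - cis (- \<theta>) * a)}"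
  then have "z = rotate_translate \<theta> a (cis (- \<theta>) * z - cis (- \<theta>) * a)" "P (cis (- \<theta>) * z - cis (- \<theta>) * a)"
    by (simp_all add: rotate_translate_def right_diff_distrib mult.assoc[symmetric] cis_mult)
  then show "z \<in> rotate_translate \<theta> a ` {z. P z}" by blast
qed (auto simp: rotate_translate_def distrib_left mult.assoc[symmetric] cis_mult)

theorem mainTheorem3:
  fixes M :: "'a measure" and Z :: "real \<Rightarrow> 'a \<Rightarrow> complex" and U W :: "complex set"
  assumes "standard_planar_brownian_motion M Z"
    and "open U" and "connected U" and "simply_connected U" and "0 \<in> U" and "U \<noteq> UNIV"
    and "open_half_plane W \<or> open_quarter_plane W" and "0 \<in> W"
    and "exit_moment_exponent M Z U > exit_moment_exponent M Z W"
  shows "filterlim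
      (\<lambda>t::real. measure M {\<omega> \<in> space M. exit_time Z W \<omega> > ennreal t} /
                 measure M {\<omega> \<in> space M. exit_time Z U \<omega> > ennreal t})
      at_top at_top"
proof -
  interpret standard_planar_brownian_motion M Z by fact
  from assms(7) show ?thesis
  proof
    assume "open_half_plane W"
    then obtain \<theta> z0 where W: "W = {z. Re (cis (- \<theta>) * z - cis (- \<theta>) * z0) > 0}"
      unfolding open_half_plane_def rotate_translate_image by auto
    \<comment> \<open>The real part of the origin in the coordinates where \<open>W\<close> is
      \<open>Re z > 0\<close>. Since \<open>cis (- \<theta>)\<close> has modulus one, this is the
      distance from \<open>0\<close> to the boundary line.\<close>
    define a where "a = - Re (cis (- \<theta>) * z0)"
    have a: "a > 0" using \<open>0 \<in> W\<close> unfolding W a_def by simp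
    have W': "W = {z. Re (cis (- \<theta>) * z) > - a}" unfolding W a_def by auto
    have "open W" unfolding W' by (intro open_Collect_less continuous_intros)
    moreover obtain c C where "c > 0"
      "\<And>t. t \<ge> 1 \<Longrightarrow> c * t powr - (1 / 2) \<le> prob {\<omega> \<in> space M. exit_time Z W \<omega> > ennreal t}"
      "\<And>t. t \<ge> 1 \<Longrightarrow> prob {\<omega> \<in> space M. exit_time Z W \<omega> > ennreal t} \<le> C * t powr - (1 / 2)"
      by (rule half_plane_tail[OF a norm_cis W']) (use that in blast)
    ultimately show ?thesis
      using assms by (intro tail_ratio[of U W c "1 / 2" C])
  next
    assume "open_quarter_plane W"
    then obtain \<theta> z0 where W: "W = {z. Re (cis (- \<theta>) * z - cis (- \<theta>) * z0) > 0 \<and> Im (cis (- \<theta>) * z - cis (- \<theta>) * z0) > 0}"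
      unfolding open_quarter_plane_def rotate_translate_image by auto
    \<comment> \<open>The coordinates of the origin in the standard quadrant, that is, its distances
      to the two lines bounding \<open>W\<close>.\<close>
    define a where "a = - Re (cis (- \<theta>) * z0)"
    define b where "b = - Im (cis (- \<theta>) * z0)"
    have ab: "a > 0" "b > 0" using \<open>0 \<in> W\<close> unfolding W a_def b_def by simp_all
    have W': "W = {z. Re (cis (- \<theta>) * z) > - a \<and> Re (- \<i> * cis (- \<theta>) * z) > - b}"
      unfolding W a_def b_def by auto
    have "open W" unfolding W' by (intro open_Collect_conj open_Collect_less continuous_intros)
    moreover obtain c C where "c > 0"
      "\<And>t. t \<ge> 1 \<Longrightarrow> c * t powr - 1 \<le> prob {\<omega> \<in> space M. exit_time Z W \<omega> > ennreal t}"
      "\<And>t. t \<ge> 1 \<Longrightarrow> prob {\<omega> \<in> space M. exit_time Z W \<omega> > ennreal t} \<le> C * t powr - 1"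
      by (rule quarter_plane_tail[OF ab norm_cis W']) (use that in blast)
    ultimately show ?thesis
      using assms by (intro tail_ratio[of U W c 1 C])
  qed
qed

end
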